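(* Let a group $\Gamma$ act by automorphisms on a leafless tree $T$ whose boundary $\partial T$ is a Cantor set. Assume that there is no proper $\Gamma$-invariant subtree of $T$ and that $\Gamma$ does not fix any point of $\partial T$. Then the commutator subgroup $[\![\Gamma]\!]'$ of the topological full group $[\![\Gamma]\!]<\mathrm{Homeo}(\partial T)$ of the induced action of $\Gamma$ on $\partial T$ is $9$-uniformly simple.
   Context: A group $G$ is called $N$-uniformly simple if for every nontrivial $f\in G$ and every nontrivial conjugacy class $C\subset G$, the element $f$ is a product of at most $N$ elements of $C^{\pm1}=C\cup C^{-1}$. Trees are (nonempty) connected graphs without cycles; a leaf is a vertex of valency one. A path is a finite or infinite sequence of consecutively adjacent vertices without backtracks (vertices with indices differing by two are distinct); a ray is a path indexed by $\mathbf N$. Ends of $T$ are classes of rays, two rays being equivalent if they coincide after deleting finite (not necessarily equinumerous) initial parts. The set of ends is the boundary $\partial T$. For an oriented edge $\vec e=(v,w)$, the halftree $T_{\vec e}$ is the set of terminal vertices of paths starting with $v,w$, and $\partial T_{\vec e}\subset\partial T$ is the set of classes of rays starting with $v,w$. The topology of $\partial T$ has the sets $\partial T_{\vec e}$ as a basis. For a group $\Gamma$ acting on a Cantor set $C$ by homeomorphisms, the topological full group is $$[\![\Gamma]\!]=\{g\in\mathrm{Homeo}(C): \text{for each }x\in C\text{ there exist a neighbourhood }U\text{ of }x\text{ and }\gamma\in\Gamma\text{ such that }g|_U=\gamma|_U\}.$$ *)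

theory Defs
  imports
    "HOL-Algebra.Generated_Groups"
    "HOL-Algebra.Group_Action"
    "HOL-Analysis.Function_Topology"
    "Graph_Theory.Digraph_Component"
begin

section \<open>Uniform simplicity\<close>

definition conj_class :: "('a, 'b) monoid_scheme \<Rightarrow> 'a \<Rightarrow> 'a set" where
  "conj_class G c = {h \<otimes>\<^bsub>G\<^esub> c \<otimes>\<^bsub>G\<^esub> inv\<^bsub>G\<^esub> h | h. h \<in> carrier G}"

definition uniformly_simple :: "nat \<Rightarrow> ('a, 'b) monoid_scheme \<Rightarrow> bool" where
  "uniformly_simple N G \<longleftrightarrow> group G \<and>
     (\<forall>f \<in> carrier G - {\<one>\<^bsub>G\<^esub>}. \<forall>C \<in> conj_class G ` carrier G - {{\<one>\<^bsub>G\<^esub>}}.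
        \<exists>xs. length xs \<le> N \<and> set xs \<subseteq> C \<union> m_inv G ` C \<and>
             f = foldr (monoid.mult G) xs \<one>\<^bsub>G\<^esub>)"

definition commutator_subgroup :: "('a, 'b) monoid_scheme \<Rightarrow> ('a, 'b) monoid_scheme" where
  "commutator_subgroup G = G\<lparr>carrier := derived G (carrier G)\<rparr>"


section \<open>Topological full groups\<close>

definition cantor_space :: "'a topology \<Rightarrow> bool" where
  "cantor_space X \<longleftrightarrow>
     X homeomorphic_space product_topology (\<lambda>_::nat. discrete_topology (UNIV :: bool set)) UNIV"

text \<open>As in \<^const>\<open>BijGroup\<close>, elements are extensional functions on \<^term>\<open>topspace X\<close>.\<close>

definition homeo_group :: "'a topology \<Rightarrow> ('a \<Rightarrow> 'a) monoid" where
  "homeo_group X =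
     BijGroup (topspace X)\<lparr>carrier := {h \<in> Bij (topspace X). homeomorphic_map X X h}\<rparr>"

definition topological_full_group ::
    "('g, 'm) monoid_scheme \<Rightarrow> 'a topology \<Rightarrow> ('g \<Rightarrow> 'a \<Rightarrow> 'a) \<Rightarrow> ('a \<Rightarrow> 'a) monoid" where
  "topological_full_group \<Gamma> X \<alpha> =
     (homeo_group X)\<lparr>carrier := {g \<in> carrier (homeo_group X).
        \<forall>x \<in> topspace X. \<exists>U. openin X U \<and> x \<in> U \<and>
          (\<exists>\<gamma> \<in> carrier \<Gamma>. \<forall>y \<in> U. g y = \<alpha> \<gamma> y)}\<rparr>"


section \<open>Trees\<close>

text \<open>
  Possibly infinite simple graphs are loopless symmetric digraphs, i.e. instances of
  \<^locale>\<open>pair_bidirected_digraph\<close>. The predicates \<^const>\<open>Digraph_Component.forest\<close> and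
  \<^const>\<open>Digraph_Component.tree\<close> are of no use for these: they count every edge
  \<open>u, v, u\<close>, traversed forth and back, as a cycle. The cycles of the undirected
  graph are those of length at least three. Nonemptiness is part of
  \<^const>\<open>Digraph_Component.connected\<close>.
\<close>

definition is_tree :: "'v pair_pre_digraph \<Rightarrow> bool" where
  "is_tree T \<longleftrightarrow> pair_bidirected_digraph T \<and> Digraph_Component.connected (with_proj T) \<and>
     \<not> (\<exists>p. pre_digraph.cycle (with_proj T) p \<and> 3 \<le> length p)"

definition leafless :: "'v pair_pre_digraph \<Rightarrow> bool" where
  "leafless T \<longleftrightarrow> (\<forall>v \<in> pverts T. out_degree (with_proj T) v \<noteq> 1)"

definition subtree :: "'v pair_pre_digraph \<Rightarrow> 'v pair_pre_digraph \<Rightarrow> bool" where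
  "subtree S T \<longleftrightarrow> is_tree S \<and> subgraph (with_proj S) (with_proj T)"


section \<open>The boundary of a tree\<close>

definition is_ray :: "'v pair_pre_digraph \<Rightarrow> (nat \<Rightarrow> 'v) \<Rightarrow> bool" where
  "is_ray T r \<longleftrightarrow> (\<forall>n. (r n, r (Suc n)) \<in> parcs T) \<and> (\<forall>n. r n \<noteq> r (n + 2))"

definition ray_equiv :: "'v pair_pre_digraph \<Rightarrow> ((nat \<Rightarrow> 'v) \<times> (nat \<Rightarrow> 'v)) set" where
  "ray_equiv T =
     {(r, s). is_ray T r \<and> is_ray T s \<and> (\<exists>m n. \<forall>k. r (m + k) = s (n + k))}"

definition tree_boundary :: "'v pair_pre_digraph \<Rightarrow> (nat \<Rightarrow> 'v) set set" where
  "tree_boundary T = Collect (is_ray T) // ray_equiv T"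

definition halftree_boundary :: "'v pair_pre_digraph \<Rightarrow> 'v \<times> 'v \<Rightarrow> (nat \<Rightarrow> 'v) set set" where
  "halftree_boundary T e =
     {ray_equiv T `` {r} | r. is_ray T r \<and> r 0 = fst e \<and> r 1 = snd e}"

definition boundary_topology :: "'v pair_pre_digraph \<Rightarrow> (nat \<Rightarrow> 'v) set topology" where
  "boundary_topology T = topology_generated_by (halftree_boundary T ` parcs T)"


section \<open>Actions on trees\<close>

definition acts_on_tree ::
    "('g, 'm) monoid_scheme \<Rightarrow> 'v pair_pre_digraph \<Rightarrow> ('g \<Rightarrow> 'v \<Rightarrow> 'v) \<Rightarrow> bool" where
  "acts_on_tree \<Gamma> T \<phi> \<longleftrightarrow> is_tree T \<and> group_action \<Gamma> (pverts T) \<phi> \<and>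
     (\<forall>g \<in> carrier \<Gamma>. \<forall>u \<in> pverts T. \<forall>v \<in> pverts T.
        (\<phi> g u, \<phi> g v) \<in> parcs T \<longleftrightarrow> (u, v) \<in> parcs T)"

definition invariant_subgraph ::
    "('g, 'm) monoid_scheme \<Rightarrow> ('g \<Rightarrow> 'v \<Rightarrow> 'v) \<Rightarrow> 'v pair_pre_digraph \<Rightarrow> bool" where
  "invariant_subgraph \<Gamma> \<phi> S \<longleftrightarrow>
     (\<forall>g \<in> carrier \<Gamma>. \<phi> g ` pverts S = pverts S \<and> map_prod (\<phi> g) (\<phi> g) ` parcs S = parcs S)"

text \<open>The image, ray by ray, of an end under an automorphism is again an end.\<close>

definition boundary_action ::
    "'v pair_pre_digraph \<Rightarrow> ('g \<Rightarrow> 'v \<Rightarrow> 'v) \<Rightarrow> 'g \<Rightarrow> (nat \<Rightarrow> 'v) set \<Rightarrow> (nat \<Rightarrow> 'v) set" where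
  "boundary_action T \<phi> g = (\<lambda>\<xi> \<in> tree_boundary T. (\<lambda>r. \<phi> g \<circ> r) ` \<xi>)"

end

(* A minimal action without fixed ends is extremely proximal on the boundary: some element maps any
   proper clopen set into any nonempty clopen set. For such an action, elements of the full group can
   be prescribed on small clopen sets, and everything is reduced to the following. Let f lie in the
   commutator subgroup and let g be a conjugate of the given nontrivial element. If x, y are supported
   on a set Y disjoint from its image under g, then [x, y] = [[g, x^-1], y] is a product of four
   conjugates of g and its inverse. Two such factors agree with f on a small set W, so f becomes a
   product of two conjugates and an element f' fixing W pointwise. The latter is a product of
   commutators of elements supported on one proper clopen set, hence, by shifting these commutators
   along disjoint translates of that set, a product of two commutators supported on some Y; this
   takes six conjugates. So eight conjugates suffice. *)

theory Submission
  imports Defs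
begin

section \<open>The group of permutations of a type\<close>

text \<open>The obstacle is that conjugating elements must come from the commutator subgroup,
  whereas proximality and gluing only produce elements of the full group. A coset argument removes
  it: every element of the full group, multiplied by a suitable one supported in any prescribed
  nonempty clopen set, lands in the commutator subgroup. Corrections are thus placed where they
  change nothing that matters. This is why the constructions keep spare nonempty clopen sets; they
  come from splitting, which is always possible since no point is isolated. Sets are also kept
  proper throughout, because only proper clopen sets can be compressed. The group-theoretic half
  sees nothing of the tree, only a Boolean algebra of sets and a group of permutations. Permutations
  of a whole type, equal to the identity off the space, have a total multiplication, so words in the
  group are computed by rewriting without membership conditions.\<close>

typedef 'a permutation = "{f :: 'a \<Rightarrow> 'a. bij f}"
  morphisms app Permutation
  by (rule exI[of _ id]) simp

lemma bij_app: "bij (app f)"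
  using app by blast

lemma app_Permutation: "bij f \<Longrightarrow> app (Permutation f) = f"
  by (simp add: Permutation_inverse)

lemma permutation_eqI: "(\<And>x. app f x = app g x) \<Longrightarrow> f = g"
  by (metis app_inverse ext)

lemma app_eq_iff: "app f x = app f y \<longleftrightarrow> x = y"
  using bij_app[of f] by (auto simp: bij_def inj_def)

text \<open>The class \<open>monoid_mult\<close> supplies associativity and
  \<open>prod_list\<close>; the laws of inverses follow separately as rewrite rules.\<close>

instantiation permutation :: (type) "{monoid_mult, inverse}"
begin

definition one_permutation where "1 = Permutation id"
definition times_permutation where "f * g = Permutation (app f \<circ> app g)"
definition inverse_permutation where "inverse f = Permutation (inv_into UNIV (app f))"
definition divide_permutation :: "'a permutation \<Rightarrow> 'a permutation \<Rightarrow> 'a permutation"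
  where "divide_permutation f g = f * inverse g"

lemma app_one [simp]: "app 1 x = x"
  by (simp add: one_permutation_def app_Permutation)

lemma app_mult [simp]: "app (f * g) x = app f (app g x)"
  by (simp add: times_permutation_def app_Permutation bij_comp bij_app)

instance
  by standard (simp_all add: permutation_eqI)

end

lemma app_app_inverse [simp]: "app f (app (inverse f) x) = x"
  by (simp add: inverse_permutation_def app_Permutation bij_app bij_imp_bij_inv
      bij_is_surj surj_f_inv_f)

lemma app_inverse_app [simp]: "app (inverse f) (app f x) = x"
  by (metis app_app_inverse app_eq_iff)

text \<open>Together with \<open>mult.assoc\<close> these rules perform free reduction: the versions
  with a trailing factor cancel inside words bracketed to the right.\<close>

lemma permutation_group_simps [simp]:
  fixes f g :: "'a permutation"
  shows "inverse f * f = 1" "f * inverse f = 1"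
    "inverse f * (f * g) = g" "f * (inverse f * g) = g"
    "inverse (f * g) = inverse g * inverse f" "inverse (1 :: 'a permutation) = 1"
    "inverse (inverse f) = f"
proof -
  show i: "inverse f * f = 1" "f * inverse f = 1"
    by (simp_all add: permutation_eqI)
  show "inverse f * (f * g) = g" "f * (inverse f * g) = g"
    by (simp_all add: permutation_eqI)
  show "inverse (f * g) = inverse g * inverse f" "inverse (1 :: 'a permutation) = 1"
    "inverse (inverse f) = f"
    by (auto intro!: permutation_eqI simp: app_eq_iff)
      (metis app_app_inverse app_eq_iff app_mult app_one)+
qed

lemma app_inverse_eq_iff: "app (inverse f) x = y \<longleftrightarrow> x = app f y"
  by auto

lemma in_image_app_iff: "x \<in> app f ` A \<longleftrightarrow> app (inverse f) x \<in> A"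
  by (metis (no_types, lifting) app_app_inverse app_inverse_app image_iff)

section \<open>Supports of permutations\<close>

definition supported_on :: "'a set \<Rightarrow> 'a permutation \<Rightarrow> bool" where
  "supported_on A f \<longleftrightarrow> (\<forall>x. x \<notin> A \<longrightarrow> app f x = x)"

lemma supported_on_mono: "supported_on A f \<Longrightarrow> A \<subseteq> B \<Longrightarrow> supported_on B f"
  by (auto simp: supported_on_def)

lemma supported_on_one: "supported_on A 1"
  by (simp add: supported_on_def)

lemma supported_on_mult: "supported_on A f \<Longrightarrow> supported_on A g \<Longrightarrow> supported_on A (f * g)"
  by (simp add: supported_on_def)

lemma supported_on_inverse: "supported_on A f \<Longrightarrow> supported_on A (inverse f)"
  by (simp add: supported_on_def app_inverse_eq_iff)

lemma supported_on_conjugate: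
  "supported_on A f \<Longrightarrow> supported_on (app g ` A) (g * f * inverse g)"
  by (auto simp: supported_on_def in_image_app_iff)

lemma supported_on_app_in: "supported_on A f \<Longrightarrow> x \<in> A \<Longrightarrow> app f x \<in> A"
  by (metis app_eq_iff supported_on_def)

text \<open>Both maps preserve \<open>A\<close> and its complement, and on each of these sets one of
  the two is the identity. Disjoint supports are the common case; the general form is needed when
  \<open>g\<close> is only known to be trivial on \<open>A\<close>.\<close>

lemma commute_if_fixes:
  assumes "supported_on A f" and "\<And>x. x \<in> A \<Longrightarrow> app g x = x"
  shows "f * g = g * f"
proof (rule permutation_eqI)
  fix x
  show "app (f * g) x = app (g * f) x"
  proof (cases "x \<in> A")
    case True
    then show ?thesis using assms supported_on_app_in by fastforce
  next
    case False
    then have "app g x \<notin> A" by (metis app_eq_iff assms(2))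
    with False assms(1) show ?thesis by (simp add: supported_on_def)
  qed
qed

lemma commute_if_disjoint:
  "supported_on A f \<Longrightarrow> supported_on B g \<Longrightarrow> A \<inter> B = {} \<Longrightarrow> f * g = g * f"
  by (rule commute_if_fixes[of A]) (auto simp: supported_on_def)

section \<open>Commutators and their products\<close>

definition commutator :: "'a permutation \<Rightarrow> 'a permutation \<Rightarrow> 'a permutation" where
  "commutator a b = a * b * inverse a * inverse b"

text \<open>For a subgroup \<open>H\<close> this is the derived subgroup: the inverse of a
  commutator is again a commutator, so closing under products is enough. The rules give induction on
  the number of commutators.\<close>

inductive_set commutator_products :: "'a permutation set \<Rightarrow> 'a permutation set"
  for H where
  one: "1 \<in> commutator_products H"
| step: "a \<in> H \<Longrightarrow> b \<in> H \<Longrightarrow> f \<in> commutator_products H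
    \<Longrightarrow> commutator a b * f \<in> commutator_products H"

lemma commutator_in_commutator_products:
  "a \<in> H \<Longrightarrow> b \<in> H \<Longrightarrow> commutator a b \<in> commutator_products H"
  by (metis commutator_products.one commutator_products.step mult_1_right)

lemma commutator_products_mult:
  "f \<in> commutator_products H \<Longrightarrow> g \<in> commutator_products H \<Longrightarrow> f * g \<in> commutator_products H"
  by (induction rule: commutator_products.induct)
    (auto simp: mult.assoc intro: commutator_products.step)

lemma commutator_products_inverse:
  "f \<in> commutator_products H \<Longrightarrow> inverse f \<in> commutator_products H"
proof (induction rule: commutator_products.induct)
  case one
  then show ?case by (simp add: commutator_products.one)
next
  case (step a b f)
  have "inverse (commutator a b * f) = inverse f * commutator b a"
    by (simp add: commutator_def mult.assoc)
  with step show ?case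
    by (simp add: commutator_products_mult commutator_in_commutator_products)
qed

lemma commutator_products_hom_image:
  assumes "f \<in> commutator_products H"
    and "\<And>a. a \<in> H \<Longrightarrow> F a \<in> K" "\<And>a. a \<in> H \<Longrightarrow> F (inverse a) = inverse (F a)"
    and "\<And>a b. F (a * b) = F a * F b" "F 1 = 1"
  shows "F f \<in> commutator_products K"
  using assms(1)
proof (induction rule: commutator_products.induct)
  case one
  then show ?case by (simp add: assms(5) commutator_products.one)
next
  case (step a b f)
  have "F (commutator a b * f) = commutator (F a) (F b) * F f"
    using step by (simp add: commutator_def assms)
  with step assms(2) show ?case by (simp add: commutator_products.step)
qed

definition perm_subgroup :: "'a permutation set \<Rightarrow> bool" where
  "perm_subgroup H \<longleftrightarrow> 1 \<in> H \<and> (\<forall>f\<in>H. \<forall>g\<in>H. f * g \<in> H) \<and> (\<forall>f\<in>H. inverse f \<in> H)"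

lemma commutator_products_subset:
  assumes "perm_subgroup H"
  shows "commutator_products H \<subseteq> H"
proof
  fix f assume "f \<in> commutator_products H"
  then show "f \<in> H"
    by (induction rule: commutator_products.induct)
      (use assms in \<open>auto simp: perm_subgroup_def commutator_def\<close>)
qed

lemma commutator_products_conjugate:
  assumes "f \<in> commutator_products H" "\<And>a. a \<in> H \<Longrightarrow> h * a * inverse h \<in> H"
  shows "h * f * inverse h \<in> commutator_products H"
  by (rule commutator_products_hom_image[OF assms(1), where F = "\<lambda>f. h * f * inverse h"])
    (use assms(2) in \<open>auto simp: mult.assoc\<close>)

section \<open>Full groups with an extremely proximal action\<close>

text \<open>Here \<open>\<C>\<close> plays the role of the algebra of clopen sets of a space without
  isolated points. The axiom \<open>full\<close> is closure under gluing: a permutation that agrees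
  near every point with some element of \<open>G\<close> belongs to \<open>G\<close>. The axiom
  \<open>proximal\<close> is extreme proximality.\<close>

locale proximal_full_group =
  fixes X :: "'a set" and \<C> :: "'a set set" and G :: "'a permutation set"
  assumes clopen_subset: "A \<in> \<C> \<Longrightarrow> A \<subseteq> X"
    and clopen_compl: "A \<in> \<C> \<Longrightarrow> X - A \<in> \<C>"
    and clopen_inter: "A \<in> \<C> \<Longrightarrow> B \<in> \<C> \<Longrightarrow> A \<inter> B \<in> \<C>"
    and clopen_whole: "X \<in> \<C>"
    and clopen_separates: "x \<in> X \<Longrightarrow> y \<in> X \<Longrightarrow> x \<noteq> y \<Longrightarrow> \<exists>A\<in>\<C>. x \<in> A \<and> y \<notin> A"
    and no_singleton: "{x} \<notin> \<C>"
    and subgroup: "perm_subgroup G"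
    and supported: "g \<in> G \<Longrightarrow> supported_on X g"
    and clopen_image: "g \<in> G \<Longrightarrow> A \<in> \<C> \<Longrightarrow> app g ` A \<in> \<C>"
    and full: "supported_on X h \<Longrightarrow>
      (\<And>x. x \<in> X \<Longrightarrow> \<exists>A\<in>\<C>. x \<in> A \<and> (\<exists>g\<in>G. \<forall>y\<in>A. app h y = app g y)) \<Longrightarrow> h \<in> G"
    and proximal: "A \<in> \<C> \<Longrightarrow> A \<noteq> X \<Longrightarrow> B \<in> \<C> \<Longrightarrow> B \<noteq> {} \<Longrightarrow> \<exists>g\<in>G. app g ` A \<subseteq> B"
begin

section \<open>Rigid stabilisers and the algebra of clopen sets\<close>

abbreviation D where "D \<equiv> commutator_products G"

definition rigid where "rigid A = {g \<in> G. supported_on A g}"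

lemma one_in [simp]: "1 \<in> G"
  and mult_in [intro]: "f \<in> G \<Longrightarrow> g \<in> G \<Longrightarrow> f * g \<in> G"
  and inverse_in [intro]: "f \<in> G \<Longrightarrow> inverse f \<in> G"
  using subgroup by (auto simp: perm_subgroup_def)

lemma D_in: "f \<in> D \<Longrightarrow> f \<in> G"
  using commutator_products_subset[OF subgroup] by blast

lemma D_conjugate: "f \<in> D \<Longrightarrow> h \<in> G \<Longrightarrow> h * f * inverse h \<in> D"
  by (rule commutator_products_conjugate) auto

lemma rigidD: "g \<in> rigid A \<Longrightarrow> g \<in> G" "g \<in> rigid A \<Longrightarrow> supported_on A g"
  by (simp_all add: rigid_def)

lemma rigid_mono: "g \<in> rigid A \<Longrightarrow> A \<subseteq> B \<Longrightarrow> g \<in> rigid B"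
  by (auto simp: rigid_def intro: supported_on_mono)

lemma rigid_mult: "f \<in> rigid A \<Longrightarrow> g \<in> rigid A \<Longrightarrow> f * g \<in> rigid A"
  by (auto simp: rigid_def supported_on_mult)

lemma rigid_inverse: "f \<in> rigid A \<Longrightarrow> inverse f \<in> rigid A"
  by (auto simp: rigid_def supported_on_inverse)

lemma rigid_one: "1 \<in> rigid A"
  by (auto simp: rigid_def supported_on_one)

lemma rigid_subgroup: "perm_subgroup (rigid A)"
  by (simp add: perm_subgroup_def rigid_mult rigid_inverse rigid_one)

lemma rigid_conjugate: "f \<in> rigid A \<Longrightarrow> g \<in> G \<Longrightarrow> g * f * inverse g \<in> rigid (app g ` A)"
  by (auto simp: rigid_def supported_on_conjugate)

lemma rigid_commute: "f \<in> rigid A \<Longrightarrow> g \<in> rigid B \<Longrightarrow> A \<inter> B = {} \<Longrightarrow> f * g = g * f"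
  by (auto simp: rigid_def intro: commute_if_disjoint)

lemma clopen_diff: "A \<in> \<C> \<Longrightarrow> B \<in> \<C> \<Longrightarrow> A - B \<in> \<C>"
  using clopen_inter[OF _ clopen_compl, of A B] clopen_subset[of A]
  by (simp add: Diff_eq Int_assoc[symmetric] Int_absorb2)

lemma clopen_union: "A \<in> \<C> \<Longrightarrow> B \<in> \<C> \<Longrightarrow> A \<union> B \<in> \<C>"
proof -
  assume "A \<in> \<C>" "B \<in> \<C>"
  moreover from this have "A \<union> B = X - ((X - A) \<inter> (X - B))"
    using clopen_subset by blast
  ultimately show ?thesis by (simp add: clopen_compl clopen_inter)
qed

lemma in_X: "g \<in> G \<Longrightarrow> x \<in> X \<Longrightarrow> app g x \<in> X"
  by (simp add: supported supported_on_app_in)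

text \<open>A nonempty clopen set has two points by \<open>no_singleton\<close>, and a clopen set
  separating them cuts it. This provides the spare room in later constructions.\<close>

lemma clopen_split:
  assumes "A \<in> \<C>" "A \<noteq> {}"
  obtains B C where "B \<in> \<C>" "C \<in> \<C>" "B \<noteq> {}" "C \<noteq> {}" "B \<inter> C = {}" "B \<union> C = A"
proof -
  obtain x where x: "x \<in> A" using assms by blast
  obtain y where y: "y \<in> A" "y \<noteq> x" using no_singleton[of x] assms x
    by (metis is_singletonI' is_singleton_def singletonD)
  obtain W where W: "W \<in> \<C>" "x \<in> W" "y \<notin> W"
    using clopen_separates[of x y] x y clopen_subset[OF assms(1)] by blast
  show ?thesis
    by (rule that[of "A \<inter> W" "A - W"])
      (use W x y assms in \<open>auto simp: clopen_inter clopen_diff\<close>)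
qed

section \<open>Gluing elements of the full group and correcting them into \<open>D\<close>\<close>

lemma full_piecewise:
  assumes "supported_on X h"
    and "\<And>x. x \<in> X \<Longrightarrow> \<exists>A g. A \<in> \<C> \<and> g \<in> G \<and> x \<in> A \<and> (\<forall>y\<in>A. app h y = app g y)"
  shows "h \<in> G"
  by (rule full[OF assms(1)]) (use assms(2) in meson)

text \<open>Exchanging \<open>W\<close> with its image, by \<open>g\<close> one way and by its
  inverse the other way, is an involution, hence bijective. It is glued from three clopen pieces and
  so stays in \<open>G\<close>, but unlike \<open>g\<close> it has controlled support.\<close>

lemma glue_swap:
  assumes "g \<in> G" "W \<in> \<C>" "app g ` W \<inter> W = {}"
  obtains t where "t \<in> rigid (W \<union> app g ` W)" "\<And>x. x \<in> W \<Longrightarrow> app t x = app g x"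
proof -
  define s where "s x = (if x \<in> W then app g x else if x \<in> app g ` W then app (inverse g) x else x)" for x
  have ss: "s (s x) = x" for x
    using assms(3) by (auto simp: s_def in_image_app_iff)
  then have "bij s" by (metis bij_betw_def injI surjI)
  then have t: "app (Permutation s) = s" by (rule app_Permutation)
  have gW: "app g ` W \<in> \<C>" by (simp add: assms clopen_image)
  have sup: "supported_on (W \<union> app g ` W) (Permutation s)"
    by (auto simp: supported_on_def t s_def)
  moreover have "Permutation s \<in> G"
  proof (rule full_piecewise)
    show "supported_on X (Permutation s)"
      using supported_on_mono[OF sup] assms(2) gW clopen_subset by blast
    fix x assume "x \<in> X"
    then consider "x \<in> W" | "x \<in> app g ` W" | "x \<in> X - W - app g ` W" by blast
    then show "\<exists>A g. A \<in> \<C> \<and> g \<in> G \<and> x \<in> A \<and> (\<forall>y\<in>A. app (Permutation s) y = app g y)"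
    proof cases
      case 1
      then show ?thesis using assms(1,2)
        by (intro exI[of _ W] exI[of _ g]) (simp add: t s_def)
    next
      case 2
      moreover have "\<forall>y\<in>app g ` W. s y = app (inverse g) y"
        using assms(3) by (auto simp: s_def)
      ultimately show ?thesis using gW inverse_in[OF assms(1)]
        by (intro exI[of _ "app g ` W"] exI[of _ "inverse g"]) (simp add: t)
    next
      case 3
      then show ?thesis using assms(2) gW
        by (intro exI[of _ "X - W - app g ` W"] exI[of _ 1])
          (simp add: t s_def clopen_diff clopen_whole)
    qed
  qed
  ultimately show ?thesis
    by (intro that[of "Permutation s"]) (auto simp: rigid_def t s_def)
qed

text \<open>A detour through the spare room \<open>R\<close> turns \<open>g\<close> on \<open>E\<close> into a product of two swaps,
  even if \<open>E\<close> meets its image.\<close>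

lemma extend_partial:
  assumes "g \<in> G" "E \<in> \<C>" "R \<in> \<C>" "R \<noteq> {}" "R \<inter> (E \<union> app g ` E) = {}"
  obtains h where "h \<in> rigid (E \<union> app g ` E \<union> R)" "\<And>x. x \<in> E \<Longrightarrow> app h x = app g x"
proof -
  have "E \<noteq> X" using assms clopen_subset by blast
  then obtain k where k: "k \<in> G" "app k ` E \<subseteq> R" using proximal[OF assms(2) _ assms(3,4)] by blast
  have kE: "app k ` E \<in> \<C>" by (simp add: assms k clopen_image)
  obtain s where s: "s \<in> rigid (E \<union> app k ` E)" "\<And>x. x \<in> E \<Longrightarrow> app s x = app k x"
    using glue_swap[OF k(1) assms(2)] k(2) assms(5) by (metis (no_types, lifting) Int_Un_distrib Int_commute disjoint_iff subsetD sup_eq_bot_iff)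
  \<comment> \<open>The second swap starts from the copy of \<open>E\<close> inside
    \<open>R\<close>. Since \<open>R\<close> misses the image of \<open>E\<close> under
    \<open>g\<close>, the disjointness that \<open>glue_swap\<close> demands holds again.\<close>
  have im: "app (g * inverse k) ` (app k ` E) = app g ` E"
    by (simp add: image_image)
  obtain t where t: "t \<in> rigid (app k ` E \<union> app g ` E)"
    "\<And>x. x \<in> app k ` E \<Longrightarrow> app t x = app (g * inverse k) x"
    using glue_swap[OF _ kE, of "g * inverse k"] assms k unfolding im by blast
  show ?thesis
  proof (rule that)
    show "t * s \<in> rigid (E \<union> app g ` E \<union> R)"
      by (rule rigid_mult; rule rigid_mono[OF t(1)] rigid_mono[OF s(1)]) (use k in auto)
    show "\<And>x. x \<in> E \<Longrightarrow> app (t * s) x = app g x" by (simp add: s t)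
  qed
qed

text \<open>The points of \<open>A\<close> that \<open>g\<close> sends out of \<open>A\<close> form
  a displaced clopen set \<open>U\<close>. One part \<open>R\<close> of it is given up: it misses
  the other part \<open>W\<close> by construction and the image of \<open>W\<close> because that
  image lies outside \<open>U\<close>.\<close>

lemma nontrivial_moves_clopen:
  assumes "g \<in> G" "g \<noteq> 1"
  obtains W R where "W \<in> \<C>" "R \<in> \<C>" "W \<noteq> {}" "R \<noteq> {}" "app g ` W \<inter> W = {}"
    "R \<inter> (W \<union> app g ` W) = {}"
proof -
  obtain x where x: "app g x \<noteq> x" using assms(2) permutation_eqI[of g 1] by auto
  then have "x \<in> X" using supported[OF assms(1)] by (auto simp: supported_on_def)
  then obtain A where A: "A \<in> \<C>" "x \<in> A" "app g x \<notin> A"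
    using clopen_separates[of x "app g x"] x in_X assms(1) by metis
  define U where "U = A - app (inverse g) ` A"
  have U: "U \<in> \<C>" "app g ` U \<inter> U = {}" "U \<noteq> {}"
    using A assms by (auto simp: U_def clopen_diff clopen_image inverse_in in_image_app_iff)
  obtain W R where "W \<in> \<C>" "R \<in> \<C>" "W \<noteq> {}" "R \<noteq> {}" "W \<inter> R = {}" "W \<union> R = U"
    using clopen_split[OF U(1,3)] .
  then show ?thesis using U(2) by (intro that[of W R]) auto
qed

text \<open>Modulo \<open>D\<close> an element equals its conjugates. If its support is proper, some
  \<open>s\<close> compresses the support into \<open>V\<close>, and \<open>h\<close> times the
  conjugate of its inverse by \<open>s\<close> is a commutator. A general \<open>h\<close> is first
  written as \<open>t * (inverse t * h)\<close> with both factors of proper support.\<close>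

lemma D_coset_rigid:
  assumes "h \<in> G" "V \<in> \<C>" "V \<noteq> {}"
  obtains k where "k \<in> rigid V" "h * k \<in> D"
proof -
  have proper: "\<exists>k\<in>rigid V. h * k \<in> D" if hA: "h \<in> rigid A" "A \<in> \<C>" "A \<noteq> X" for h A
  proof -
    obtain s where s: "s \<in> G" "app s ` A \<subseteq> V" using proximal[OF hA(2,3) assms(2,3)] by blast
    have "s * inverse h * inverse s \<in> rigid V"
      using rigid_mono[OF rigid_conjugate[OF rigid_inverse[OF hA(1)] s(1)] s(2)] .
    moreover have "h * (s * inverse h * inverse s) \<in> D"
      using commutator_in_commutator_products[of h G s] rigidD(1)[OF hA(1)] s(1)
      by (simp add: commutator_def mult.assoc)
    ultimately show ?thesis by blast
  qed
  have "\<exists>k\<in>rigid V. h * k \<in> D"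
  proof (cases "h = 1")
    case True
    then show ?thesis by (metis rigid_one mult_1 commutator_products.one)
  next
    case False
    then obtain W R where W: "W \<in> \<C>" "R \<in> \<C>" "W \<noteq> {}" "R \<noteq> {}" "app h ` W \<inter> W = {}"
      "R \<inter> (W \<union> app h ` W) = {}"
      using nontrivial_moves_clopen[OF assms(1)] by blast
    obtain t where t: "t \<in> rigid (W \<union> app h ` W)" "\<And>x. x \<in> W \<Longrightarrow> app t x = app h x"
      using glue_swap[OF assms(1) W(1,5)] by blast
    have tG: "inverse t * h \<in> G" using rigidD(1)[OF t(1)] assms(1) by blast
    have "app (inverse t * h) x = x" if "x \<notin> X - W" for x
      using that supported[OF tG] t(2)[of x] by (cases "x \<in> W") (auto simp: supported_on_def app_inverse_eq_iff)
    with tG have "inverse t * h \<in> rigid (X - W)" by (simp add: rigid_def supported_on_def)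
    moreover have "X - W \<in> \<C>" "X - W \<noteq> X"
      using W(3) clopen_subset[OF W(1)] clopen_compl[OF W(1)] by blast+
    ultimately obtain k where k: "k \<in> rigid V" "inverse t * h * k \<in> D" using proper by blast
    have "W \<union> app h ` W \<in> \<C>" "W \<union> app h ` W \<noteq> X"
      using W(1,2,4,6) assms(1) clopen_subset[of R] clopen_union clopen_image by blast+
    then obtain l where l: "l \<in> rigid V" "t * l \<in> D" using proper t(1) by blast
    \<comment> \<open>Normality of \<open>D\<close> lets the corrections of the two factors be
      collected at the right end.\<close>
    have "h * (k * l) = t * (inverse t * h * k) * inverse t * (t * l)"
      by (simp add: mult.assoc)
    moreover have "\<dots> \<in> D"
      by (intro commutator_products_mult D_conjugate k l rigidD(1)[OF t(1)])
    ultimately show ?thesis using rigid_mult[OF k(1) l(1)] by metis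
  qed
  with that show ?thesis by blast
qed

text \<open>If \<open>c\<close> displaces \<open>U\<close> and \<open>t\<close> squeezes
  \<open>Y\<close> into \<open>U\<close>, then conjugating \<open>c\<close> by
  \<open>inverse t\<close> displaces \<open>Y\<close>. To conjugate by an element of
  \<open>D\<close>, \<open>inverse t\<close> is corrected by a \<open>k\<close> that fixes
  \<open>U\<close> pointwise and is therefore invisible on the image of \<open>Y\<close>.\<close>

lemma D_conjugate_displaces:
  assumes "c \<in> G" "c \<noteq> 1" "Y \<in> \<C>" "Y \<noteq> X"
  obtains h where "h \<in> D" "app (h * c * inverse h) ` Y \<inter> Y = {}"
proof -
  obtain U where U: "U \<in> \<C>" "U \<noteq> {}" "app c ` U \<inter> U = {}"
    using nontrivial_moves_clopen[OF assms(1,2)] by metis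
  obtain t where t: "t \<in> G" "app t ` Y \<subseteq> U" using proximal[OF assms(3,4) U(1,2)] by blast
  have "X - U \<noteq> {}"
    using U clopen_subset[OF clopen_image[OF assms(1) U(1)]] by blast
  then obtain k where k: "k \<in> rigid (X - U)" "inverse t * k \<in> D"
    using D_coset_rigid[of "inverse t" "X - U"] t U(1) by (metis clopen_compl inverse_in)
  have *: "app (inverse k) y = y" if "y \<in> U" for y
    using rigidD(2)[OF rigid_inverse[OF k(1)]] that by (auto simp: supported_on_def)
  have Y: "app (inverse k * t) y \<in> U" if "y \<in> Y" for y
    using * t(2) that by auto
  show ?thesis
  proof (rule that[OF k(2)], intro equals0I, elim IntE imageE)
    fix x y assume xy: "x \<in> Y" "y \<in> Y" "x = app (inverse t * k * c * inverse (inverse t * k)) y"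
    from xy(3) have "app (inverse k * t) x = app c (app (inverse k * t) y)"
      by (simp add: mult.assoc)
    with Y[OF xy(1)] Y[OF xy(2)] U(3) show False by (metis IntI emptyE imageI)
  qed
qed

text \<open>The group embeds into a proper rigid stabiliser: transport everything along the injection that
  is the identity on \<open>A\<close> and compresses the complement of \<open>A\<close>. Elements supported on \<open>A\<close> do not
  change.\<close>

lemma D_rigid_in_rigid_D:
  assumes f: "f \<in> D" "f \<in> rigid A" and A: "A \<in> \<C>" "A \<noteq> X"
  obtains B where "B \<in> \<C>" "B \<noteq> X" "f \<in> commutator_products (rigid B)"
\<comment> \<open>For empty \<open>A\<close> the complement is all of \<open>X\<close> and cannot be
  compressed, but then \<open>f\<close> is trivial.\<close>
proof (cases "A = {}")
  case True
  then have "f = 1" using rigidD(2)[OF f(2)] by (auto simp: supported_on_def intro: permutation_eqI)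
  then show ?thesis using that[OF A] by (simp add: commutator_products.one)
next
  case False
  have "X - A \<in> \<C>" "X - A \<noteq> {}" using A clopen_subset by (auto simp: clopen_compl)
  \<comment> \<open>The complement of \<open>A\<close> is to be compressed into \<open>R\<close>;
    the part \<open>S\<close> stays outside the image \<open>B\<close> and keeps it proper.\<close>
  then obtain R S where RS: "R \<in> \<C>" "S \<in> \<C>" "R \<noteq> {}" "S \<noteq> {}" "R \<inter> S = {}" "R \<union> S = X - A"
    using clopen_split by metis
  have "X - A \<noteq> X" using False clopen_subset[OF A(1)] by blast
  then obtain g where g: "g \<in> G" "app g ` (X - A) \<subseteq> R"
    using proximal[OF clopen_compl[OF A(1)]] RS by blast
  define \<psi> where "\<psi> x = (if x \<in> A then x else app g x)" for x
  define B where "B = \<psi> ` X"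
  define \<rho> where "\<rho> = inv_into X \<psi>"
  have B_eq: "B = A \<union> app g ` (X - A)"
    using clopen_subset[OF A(1)] by (auto simp: B_def \<psi>_def)
  have B: "B \<in> \<C>" "B \<subseteq> X"
    unfolding B_eq using A g(1) clopen_subset
    by (auto simp: clopen_union clopen_image clopen_compl in_X)
  have "S \<inter> B = {}" "S \<subseteq> X" using RS g(2) by (auto simp: B_eq)
  then have "B \<noteq> X" using RS by blast
  have inj: "inj_on \<psi> X"
    using g(2) RS by (auto simp: inj_on_def \<psi>_def app_eq_iff)
  have \<rho>\<psi>: "\<rho> (\<psi> x) = x" if "x \<in> X" for x using inj that by (simp add: \<rho>_def)
  have \<psi>\<rho>: "\<psi> (\<rho> y) = y" and \<rho>X: "\<rho> y \<in> X" if "y \<in> B" for y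
    using that by (simp_all add: \<rho>_def B_def f_inv_into_f inv_into_into)
  have \<psi>B: "\<psi> x \<in> B" if "x \<in> X" for x using that by (simp add: B_def)
  \<comment> \<open>Since \<open>\<psi>\<close> agrees locally with elements of \<open>G\<close>,
    conjugating by it leads locally to elements \<open>q * h * inverse p\<close>, so the result is
    again in the full group.\<close>
  have piece: "\<exists>P p. P \<in> \<C> \<and> x \<in> P \<and> p \<in> G \<and> (\<forall>y\<in>P. \<psi> y = app p y)" if "x \<in> X" for x
  proof (cases "x \<in> A")
    case True
    then show ?thesis using A(1) by (intro exI[of _ A] exI[of _ 1]) (simp add: \<psi>_def)
  next
    case False
    then show ?thesis using that clopen_compl[OF A(1)] g(1)
      by (intro exI[of _ "X - A"] exI[of _ g]) (simp add: \<psi>_def)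
  qed
  define \<Phi>' where "\<Phi>' h y = (if y \<in> B then \<psi> (app h (\<rho> y)) else y)" for h y
  define \<Phi> where "\<Phi> h = Permutation (\<Phi>' h)" for h
  have \<Phi>'_comp: "\<Phi>' (h * k) y = \<Phi>' h (\<Phi>' k y)" if "k \<in> G" for h k y
    using that by (simp add: \<Phi>'_def \<psi>B \<rho>X in_X \<rho>\<psi>)
  have \<Phi>'_one: "\<Phi>' 1 y = y" for y by (simp add: \<Phi>'_def \<psi>\<rho>)
  have bij: "bij (\<Phi>' h)" if "h \<in> G" for h
  proof (rule o_bij)
    show "\<Phi>' (inverse h) \<circ> \<Phi>' h = id" "\<Phi>' h \<circ> \<Phi>' (inverse h) = id"
      using \<Phi>'_comp[OF that, of "inverse h"] \<Phi>'_comp[OF inverse_in[OF that], of h]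
      by (simp_all add: fun_eq_iff \<Phi>'_one)
  qed
  have app\<Phi>: "app (\<Phi> h) = \<Phi>' h" if "h \<in> G" for h
    unfolding \<Phi>_def by (rule app_Permutation[OF bij[OF that]])
  have \<Phi>_mult: "\<Phi> (h * k) = \<Phi> h * \<Phi> k" if "h \<in> G" "k \<in> G" for h k
    using that by (auto intro!: permutation_eqI simp: app\<Phi> mult_in \<Phi>'_comp)
  have \<Phi>_one: "\<Phi> 1 = 1" by (auto intro!: permutation_eqI simp: app\<Phi> \<Phi>'_one)
  have \<Phi>_inverse: "\<Phi> (inverse h) = inverse (\<Phi> h)" if "h \<in> G" for h
    using \<Phi>_mult[OF inverse_in[OF that] that] \<Phi>_one
    by (metis permutation_group_simps(1,2) mult.assoc mult_1 mult_1_right)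
  have \<Phi>_rigid: "\<Phi> h \<in> rigid B" if h: "h \<in> G" for h
  proof -
    have sup: "supported_on B (\<Phi> h)" by (auto simp: supported_on_def app\<Phi>[OF h] \<Phi>'_def)
    moreover have "\<Phi> h \<in> G"
    proof (rule full_piecewise)
      show "supported_on X (\<Phi> h)" by (rule supported_on_mono[OF sup B(2)])
      fix y assume "y \<in> X"
      show "\<exists>A g. A \<in> \<C> \<and> g \<in> G \<and> y \<in> A \<and> (\<forall>z\<in>A. app (\<Phi> h) z = app g z)"
      proof (cases "y \<in> B")
        case True
        define x where "x = \<rho> y"
        have x: "x \<in> X" "y = \<psi> x" using True by (simp_all add: x_def \<rho>X \<psi>\<rho>)
        obtain P p where P: "P \<in> \<C>" "x \<in> P" "p \<in> G" "\<forall>z\<in>P. \<psi> z = app p z"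
          using piece[OF x(1)] by blast
        obtain Q q where Q: "Q \<in> \<C>" "app h x \<in> Q" "q \<in> G" "\<forall>z\<in>Q. \<psi> z = app q z"
          using piece[OF in_X[OF h x(1)]] by blast
        \<comment> \<open>The piece around \<open>x\<close> on which \<open>\<psi>\<close> is
          \<open>p\<close> before applying \<open>h\<close> and \<open>q\<close> afterwards; its
          image under \<open>p\<close> is the required neighbourhood of \<open>y\<close>.\<close>
        let ?W = "P \<inter> app (inverse h) ` Q"
        have W: "?W \<in> \<C>" "x \<in> ?W" using P Q h
          by (auto simp: clopen_inter clopen_image inverse_in in_image_app_iff)
        have "app (\<Phi> h) z = app (q * h * inverse p) z" if zW: "z \<in> app p ` ?W" for z
        proof -
          obtain w where w: "w \<in> P" "w \<in> app (inverse h) ` Q" "z = app p w"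
            using zW by blast
          then have "app h w \<in> Q" by (simp add: in_image_app_iff)
          have "w \<in> X" using w P clopen_subset by blast
          then have "app (\<Phi> h) (\<psi> w) = \<psi> (app h w)" by (simp add: app\<Phi>[OF h] \<Phi>'_def \<psi>B \<rho>\<psi>)
          moreover have "\<psi> w = z" "\<psi> (app h w) = app q (app h w)"
            using w P Q \<open>app h w \<in> Q\<close> by simp_all
          ultimately show ?thesis by (simp add: w(3))
        qed
        moreover have "app p ` ?W \<in> \<C>" "y \<in> app p ` ?W" using W P x by (auto simp: clopen_image)
        moreover have "q * h * inverse p \<in> G" using P Q h by blast
        ultimately show ?thesis
          by (intro exI[of _ "app p ` ?W"] exI[of _ "q * h * inverse p"]) simp
      next
        case False
        then show ?thesis using \<open>y \<in> X\<close> clopen_compl[OF B(1)]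
          by (intro exI[of _ "X - B"] exI[of _ 1]) (simp add: app\<Phi>[OF h] \<Phi>'_def)
      qed
    qed
    ultimately show ?thesis by (simp add: rigid_def)
  qed
  have "\<Phi> f = f"
  proof (rule permutation_eqI)
    fix y
    have sup: "supported_on A f" by (rule rigidD(2)[OF f(2)])
    have fG: "f \<in> G" by (rule rigidD(1)[OF f(2)])
    show "app (\<Phi> f) y = app f y"
    proof (cases "y \<in> A")
      case True
      then have "y \<in> X" "\<psi> y = y" using clopen_subset[OF A(1)] by (auto simp: \<psi>_def)
      then have "y \<in> B" "\<rho> y = y" using \<psi>B[of y] \<rho>\<psi>[of y] by auto
      with True show ?thesis
        using supported_on_app_in[OF sup True] by (simp add: app\<Phi>[OF fG] \<Phi>'_def \<psi>_def)
    next
      case False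
      have "\<rho> y \<notin> A" if "y \<in> B"
        using \<psi>\<rho>[OF that] False by (auto simp: \<psi>_def)
      then show ?thesis using sup False by (auto simp: app\<Phi>[OF fG] \<Phi>'_def supported_on_def \<psi>\<rho>)
    qed
  qed
  \<comment> \<open>\<open>\<Phi>\<close> is multiplicative only on \<open>G\<close>, whose elements
    preserve \<open>X\<close>, so \<open>commutator_products_hom_image\<close> does not apply and
    the induction is carried out directly.\<close>
  moreover have "\<Phi> f \<in> commutator_products (rigid B)"
    using f(1)
  proof (induction rule: commutator_products.induct)
    case one
    then show ?case by (simp add: \<Phi>_one commutator_products.one)
  next
    case (step a b f)
    then have "\<Phi> (commutator a b * f) = commutator (\<Phi> a) (\<Phi> b) * \<Phi> f"
      by (simp add: commutator_def \<Phi>_mult \<Phi>_inverse mult_in inverse_in D_in)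
    with step show ?case by (simp add: commutator_products.step \<Phi>_rigid)
  qed
  ultimately show ?thesis using that B(1) \<open>B \<noteq> X\<close> by simp
qed

section \<open>Compressing a product of commutators to two commutators\<close>

lemma commutator_mult_of_commuting:
  assumes "a \<in> rigid A" "b \<in> rigid A" "a' \<in> rigid B" "b' \<in> rigid B" "A \<inter> B = {}"
  shows "commutator (a * a') (b * b') = commutator a b * commutator a' b'"
proof -
  have c: "y * x = x * y" "y * (x * z) = x * (y * z)"
    if "x \<in> rigid A" "y \<in> rigid B" for x y z
    using rigid_commute[OF that assms(5)] by (simp_all flip: mult.assoc)
  show ?thesis
    using assms(1-4)
    by (simp add: commutator_def mult.assoc rigid_inverse c[of b a'] c[of b b']
        c[of "inverse a" a'] c[of "inverse a" b'] c[of "inverse b" a'] c[of "inverse b" b']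
        c[of "inverse a" "inverse a'"] c[of "inverse b" "inverse a'"] c[of "inverse b" "inverse b'"])
qed

lemma commutator_rigid: "a \<in> rigid A \<Longrightarrow> b \<in> rigid A \<Longrightarrow> commutator a b \<in> rigid A"
  by (simp add: commutator_def rigid_mult rigid_inverse)

text \<open>For \<open>f = c\<^sub>1 \<cdots> c\<^sub>m\<close> the factor \<open>F\<close> is the product of the \<open>\<gamma>\<^sup>i c\<^sub>i\<^sub>+\<^sub>1 \<cdots> c\<^sub>m \<gamma>\<^sup>-\<^sup>i\<close>,
  while \<open>[a, b]\<close> is the product of the commuting elements \<open>\<gamma>\<^sup>i c\<^sub>i \<gamma>\<^sup>-\<^sup>i\<close>, hence a single commutator.\<close>

lemma two_commutators_telescope:
  assumes f: "f \<in> commutator_products (rigid B)"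
    and \<gamma>: "\<gamma> \<in> G" "B \<subseteq> Y" "app \<gamma> ` Y \<subseteq> Y - B"
  shows "\<exists>F\<in>rigid Y. \<exists>a\<in>rigid (app \<gamma> ` Y). \<exists>b\<in>rigid (app \<gamma> ` Y).
    f = F * \<gamma> * inverse F * inverse \<gamma> * commutator a b"
  using f
proof (induction rule: commutator_products.induct)
  case one
  show ?case
    by (rule bexI[of _ 1], rule bexI[of _ 1], rule bexI[of _ 1])
      (simp_all add: commutator_def rigid_one)
next
  case (step a b f)
  then obtain F a' b' where IH: "F \<in> rigid Y" "a' \<in> rigid (app \<gamma> ` Y)" "b' \<in> rigid (app \<gamma> ` Y)"
    "f = F * \<gamma> * inverse F * inverse \<gamma> * commutator a' b'" by blast
  define c where "c = commutator a b"
  define K where "K = commutator a' b'"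
  have disj: "B \<inter> app \<gamma> ` Y = {}" and sub: "app \<gamma> ` Y \<subseteq> Y" using \<gamma> by auto
  have fB: "f \<in> rigid B" using commutator_products_subset[OF rigid_subgroup] step by blast
  have cB: "c \<in> rigid B" unfolding c_def using step by (simp add: commutator_rigid)
  have KY: "K \<in> rigid (app \<gamma> ` Y)" unfolding K_def using IH by (simp add: commutator_rigid)
  \<comment> \<open>Prepending \<open>c\<close> raises the index of every old factor by one, that
    is, conjugates \<open>F\<close> by \<open>\<gamma>\<close>, and adds the whole product
    \<open>c * f\<close> at index 0.\<close>
  define F' where "F' = c * f * (\<gamma> * F * inverse \<gamma>)"
  have "F' \<in> rigid Y" unfolding F'_def
    using rigid_mono[OF rigid_mult[OF cB fB] \<gamma>(2)] rigid_mono[OF rigid_conjugate[OF IH(1) \<gamma>(1)] sub]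
    by (rule rigid_mult)
  \<comment> \<open>The new commutator and the old one have disjoint supports, hence merge into one;
    the outer conjugation is again the shift of indices.\<close>
  define p where "p = \<gamma> * (a * a') * inverse \<gamma>"
  define q where "q = \<gamma> * (b * b') * inverse \<gamma>"
  have pq: "p \<in> rigid (app \<gamma> ` Y)" "q \<in> rigid (app \<gamma> ` Y)"
    unfolding p_def q_def
    by (rule rigid_conjugate[OF rigid_mult[OF rigid_mono[OF _ \<gamma>(2)] rigid_mono[OF _ sub]] \<gamma>(1)];
        rule step IH)+
  have "commutator p q = \<gamma> * commutator (a * a') (b * b') * inverse \<gamma>"
    by (simp add: p_def q_def commutator_def mult.assoc)
  also have "\<dots> = \<gamma> * (c * K) * inverse \<gamma>"
    unfolding c_def K_def using commutator_mult_of_commuting[OF step(1,2) IH(2,3) disj] by simp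
  finally have pq_eq: "commutator p q = \<gamma> * (c * K) * inverse \<gamma>" .
  \<comment> \<open>The induction hypothesis solved for the telescoping part, with a tail
    \<open>x\<close> so that it rewrites inside a right-bracketed word.\<close>
  have M: "F * (\<gamma> * (inverse F * (inverse \<gamma> * x))) = f * (inverse K * x)" for x
    by (simp add: IH(4) K_def mult.assoc)
  have "F' * \<gamma> * inverse F' * inverse \<gamma> * commutator p q
      = c * (f * (\<gamma> * (F * (\<gamma> * (inverse F * (inverse \<gamma> * (inverse f * (K * inverse \<gamma>))))))))"
    by (simp add: F'_def pq_eq mult.assoc)
  \<comment> \<open>After \<open>M\<close>, the factors \<open>f\<close> and
    \<open>inverse K\<close> are exchanged, their supports being disjoint; then everything after
    \<open>c * f\<close> cancels.\<close>
  also have "\<dots> = c * (f * (\<gamma> * (inverse K * (f * (inverse f * (K * inverse \<gamma>))))))"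
    unfolding M using rigid_commute[OF fB rigid_inverse[OF KY] disj] by (metis mult.assoc)
  also have "\<dots> = c * f" by simp
  finally have "commutator a b * f = F' * \<gamma> * inverse F' * inverse \<gamma> * commutator p q"
    by (simp add: c_def)
  with \<open>F' \<in> rigid Y\<close> pq show ?case by blast
qed

text \<open>The corrections of \<open>a\<close> and \<open>b\<close> are placed in disjoint parts of
  \<open>V\<close>. They commute with each other and with everything on \<open>Y\<close>, so the
  commutator does not notice them. Its entries later serve as conjugators and must therefore lie in
  \<open>D\<close>.\<close>

lemma commutator_in_D_rigid:
  assumes "a \<in> rigid Y" "b \<in> rigid Y" "V \<in> \<C>" "V \<noteq> {}" "V \<inter> Y = {}"
  obtains a' b' where "a' \<in> rigid (Y \<union> V)" "b' \<in> rigid (Y \<union> V)" "a' \<in> D" "b' \<in> D"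
    "commutator a b = commutator a' b'"
proof -
  obtain V1 V2 where V: "V1 \<in> \<C>" "V2 \<in> \<C>" "V1 \<noteq> {}" "V2 \<noteq> {}" "V1 \<inter> V2 = {}" "V1 \<union> V2 = V"
    using clopen_split[OF assms(3,4)] .
  obtain k where k: "k \<in> rigid V1" "a * k \<in> D"
    using D_coset_rigid[OF rigidD(1)[OF assms(1)] V(1,3)] .
  obtain l where l: "l \<in> rigid V2" "b * l \<in> D"
    using D_coset_rigid[OF rigidD(1)[OF assms(2)] V(2,4)] .
  have kl: "k \<in> rigid V" "l \<in> rigid V" using rigid_mono[OF k(1)] rigid_mono[OF l(1)] V by auto
  have "k * l = l * k" using rigid_commute[OF k(1) l(1) V(5)] .
  then have "commutator k l = 1" by (simp add: commutator_def mult.assoc)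
  then have "commutator (a * k) (b * l) = commutator a b"
    using commutator_mult_of_commuting[OF assms(1,2) kl] assms(5) by (simp add: Int_commute)
  then show ?thesis
    using k(2) l(2) rigid_mono[OF assms(1)] rigid_mono[OF assms(2)] rigid_mono[OF kl(1)] rigid_mono[OF kl(2)]
    by (intro that[of "a * k" "b * l"]) (auto intro: rigid_mult)
qed

lemma two_commutators:
  assumes "f \<in> D" "f \<in> rigid A" "A \<in> \<C>" "A \<noteq> X"
  obtains Y x y z w where "Y \<in> \<C>" "Y \<noteq> X" "{x, y, z, w} \<subseteq> rigid Y \<inter> D"
    "f = commutator x y * commutator z w"
proof -
  obtain B where B: "B \<in> \<C>" "B \<noteq> X" "f \<in> commutator_products (rigid B)"
    using D_rigid_in_rigid_D[OF assms] .
  have "X - B \<in> \<C>" "X - B \<noteq> {}" using B clopen_subset[OF B(1)] by (auto simp: clopen_compl)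
  \<comment> \<open>The complement of \<open>B\<close> is cut into four parts: \<open>V\<close>
    receives the image of \<open>Y\<close> under \<open>\<gamma>\<close>, \<open>R\<close> is the
    spare room for \<open>extend_partial\<close>, \<open>V'\<close> holds the corrections into
    \<open>D\<close>, and \<open>S''\<close> keeps the final support proper.\<close>
  then obtain V S where S: "V \<in> \<C>" "S \<in> \<C>" "V \<noteq> {}" "S \<noteq> {}" "V \<inter> S = {}" "V \<union> S = X - B"
    by (rule clopen_split)
  obtain R S' where R: "R \<in> \<C>" "S' \<in> \<C>" "R \<noteq> {}" "S' \<noteq> {}" "R \<inter> S' = {}" "R \<union> S' = S"
    using clopen_split[OF S(2,4)] .
  obtain V' S'' where V': "V' \<in> \<C>" "S'' \<in> \<C>" "V' \<noteq> {}" "S'' \<noteq> {}" "V' \<inter> S'' = {}" "V' \<union> S'' = S'"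
    using clopen_split[OF R(2,4)] .
  define Y where "Y = B \<union> V"
  define Z where "Z = Y \<union> R"
  have Y: "Y \<in> \<C>" "Y \<noteq> X" "R \<inter> Y = {}" "V' \<inter> Z = {}" "Z \<union> V' \<in> \<C>" "Z \<union> V' \<noteq> X"
    unfolding Y_def Z_def
    by (simp_all add: B S R V' clopen_union)
      (use S(3-6) R(3-6) V'(3-6) clopen_subset[OF B(1)] in blast)+
  obtain \<gamma> where \<gamma>: "\<gamma> \<in> G" "app \<gamma> ` Y \<subseteq> V" using proximal[OF Y(1,2) S(1,3)] by blast
  have \<gamma>Y: "app \<gamma> ` Y \<subseteq> Y - B" "B \<subseteq> Y" using \<gamma>(2) S(6) by (auto simp: Y_def)
  obtain F a b where F: "F \<in> rigid Y" "a \<in> rigid (app \<gamma> ` Y)" "b \<in> rigid (app \<gamma> ` Y)"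
    "f = F * \<gamma> * inverse F * inverse \<gamma> * commutator a b"
    using two_commutators_telescope[OF B(3) \<gamma>(1) \<gamma>Y(2,1)] by blast
  \<comment> \<open>The support of \<open>\<gamma>\<close> is not controlled. As
    \<open>\<gamma>\<close> only conjugates an element supported on \<open>Y\<close>, it can be
    replaced by any \<open>h\<close> agreeing with it there.\<close>
  obtain h where h: "h \<in> rigid (Y \<union> app \<gamma> ` Y \<union> R)" "\<And>x. x \<in> Y \<Longrightarrow> app h x = app \<gamma> x"
    using extend_partial[OF \<gamma>(1) Y(1) R(1,3)] Y(3) \<gamma>Y(1) by blast
  have "inverse F * (inverse h * \<gamma>) = (inverse h * \<gamma>) * inverse F"
    by (rule commute_if_fixes[of Y])
      (simp_all add: rigidD(2)[OF rigid_inverse[OF F(1)]] app_inverse_eq_iff h(2))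
  then have "h * (inverse F * (inverse h * \<gamma>)) * inverse \<gamma> = h * ((inverse h * \<gamma>) * inverse F) * inverse \<gamma>"
    by simp
  then have "\<gamma> * inverse F * inverse \<gamma> = h * inverse F * inverse h"
    by (simp add: mult.assoc)
  then have f: "f = commutator F h * commutator a b"
    by (simp add: F(4) commutator_def mult.assoc)
  have sub: "Y \<subseteq> Z" "app \<gamma> ` Y \<subseteq> Z" "Y \<union> app \<gamma> ` Y \<union> R \<subseteq> Z"
    using \<gamma>Y(1) by (auto simp: Z_def)
  obtain x y where "x \<in> rigid (Z \<union> V')" "y \<in> rigid (Z \<union> V')" "x \<in> D" "y \<in> D"
    "commutator F h = commutator x y"
    by (rule commutator_in_D_rigid[OF rigid_mono[OF F(1) sub(1)] rigid_mono[OF h(1) sub(3)] V'(1,3) Y(4)])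
  moreover obtain z w where "z \<in> rigid (Z \<union> V')" "w \<in> rigid (Z \<union> V')" "z \<in> D" "w \<in> D"
    "commutator a b = commutator z w"
    by (rule commutator_in_D_rigid[OF rigid_mono[OF F(2) sub(2)] rigid_mono[OF F(3) sub(2)] V'(1,3) Y(4)])
  ultimately show ?thesis using f by (intro that[OF Y(5,6), of x y z w]) auto
qed

section \<open>Counting conjugates under the commutator subgroup\<close>

definition conjugates :: "'a permutation \<Rightarrow> 'a permutation set" where
  "conjugates c = {h * c * inverse h | h. h \<in> D}"

lemma conjugates_conjugate:
  assumes "g \<in> conjugates c" "h \<in> D"
  shows "h * g * inverse h \<in> conjugates c"
proof -
  obtain k where "k \<in> D" "g = k * c * inverse k" using assms by (auto simp: conjugates_def)
  then have "h * g * inverse h = (h * k) * c * inverse (h * k)" "h * k \<in> D"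
    using assms(2) by (simp_all add: mult.assoc commutator_products_mult)
  then show ?thesis unfolding conjugates_def by blast
qed

lemma conjugates_inverse: "g \<in> conjugates c \<Longrightarrow> inverse g \<in> conjugates (inverse c)"
  by (force simp: conjugates_def mult.assoc)

lemma displacing_conjugate:
  assumes "c \<in> D" "c \<noteq> 1" "Y \<in> \<C>" "Y \<noteq> X"
  obtains g where "g \<in> conjugates c" "g \<in> D" "app g ` Y \<inter> Y = {}"
proof -
  obtain h where h: "h \<in> D" "app (h * c * inverse h) ` Y \<inter> Y = {}"
    using D_conjugate_displaces[OF D_in[OF assms(1)] assms(2-4)] .
  then show ?thesis
    using D_conjugate[OF assms(1) D_in[OF h(1)]] by (intro that[OF _ _ h(2)]) (auto simp: conjugates_def)
qed

text \<open>\<open>commutator g (inverse y)\<close> is \<open>y\<close> preceded by a conjugate of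
  its inverse supported on the image of \<open>Y\<close>. That extra factor commutes with both
  \<open>x\<close> and \<open>y\<close> and drops out of the commutator; the same holds in the first
  entry.\<close>

lemma commutator_displaced:
  assumes "x \<in> rigid Y" "y \<in> rigid Y" "g \<in> G" "app g ` Y \<inter> Y = {}"
  shows "commutator x y = commutator x (commutator g (inverse y))"
    "commutator x y = commutator (commutator g (inverse x)) y"
proof -
  have c: "commutator x (z * y) = commutator x y" "commutator (z * x) y = commutator x y"
    if "z \<in> rigid (app g ` Y)" for z
  proof -
    have "x * z = z * x" "y * z = z * y"
      using rigid_commute[OF assms(1) that] rigid_commute[OF assms(2) that] assms(4)
      by (simp_all add: Int_commute)
    then have "x * (z * u) = z * (x * u)" "y * (z * u) = z * (y * u)"
      "inverse x * (inverse z * u) = inverse z * (inverse x * u)"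
      "inverse y * (inverse z * u) = inverse z * (inverse y * u)" for u
      by (metis mult.assoc permutation_group_simps(5))+
    then show "commutator x (z * y) = commutator x y" "commutator (z * x) y = commutator x y"
      unfolding commutator_def
      by (simp_all add: mult.assoc) (metis mult.assoc permutation_group_simps)+
  qed
  have e: "commutator g (inverse u) = (g * inverse u * inverse g) * u" for u :: "'a permutation"
    by (simp add: commutator_def)
  show "commutator x y = commutator x (commutator g (inverse y))"
    "commutator x y = commutator (commutator g (inverse x)) y"
    unfolding e by (rule c[symmetric], rule rigid_conjugate[OF rigid_inverse]; fact)+
qed

text \<open>With \<open>[x, y] = [x, [g, y\<^sup>-\<^sup>1]]\<close> and \<open>[z, w] = [[g, z\<^sup>-\<^sup>1], w]\<close>, each a product of four conjugates
  of \<open>g\<close> and its inverse, the last factor of the former cancels the first factor of the latter.\<close>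

lemma six_conjugates:
  assumes "f \<in> D" "f \<in> rigid A" "A \<in> \<C>" "A \<noteq> X" "c \<in> D" "c \<noteq> 1"
  obtains xs where "length xs = 6" "set xs \<subseteq> conjugates c \<union> conjugates (inverse c)" "f = prod_list xs"
proof -
  obtain Y x y z w where Y: "Y \<in> \<C>" "Y \<noteq> X" "{x, y, z, w} \<subseteq> rigid Y \<inter> D"
    "f = commutator x y * commutator z w"
    using two_commutators[OF assms(1-4)] .
  \<comment> \<open>A single \<open>g\<close> serves both commutators because all four entries live
    on the same \<open>Y\<close>; only thus can a factor of one cancel against a factor of the
    other.\<close>
  obtain g where g: "g \<in> conjugates c" "g \<in> D" "app g ` Y \<inter> Y = {}"
    using displacing_conjugate[OF assms(5,6) Y(1,2)] .
  define C where "C h u = h * u * inverse h" for h u :: "'a permutation"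
  have conj: "C h g \<in> conjugates c" "C h (inverse g) \<in> conjugates (inverse c)" if "h \<in> D" for h
    using that g(1) by (simp_all add: C_def conjugates_conjugate conjugates_inverse)
  let ?xs = "[C x g, C (x * inverse y) (inverse g), C (inverse y) g,
      C (inverse z) (inverse g), C (w * inverse z) g, C w (inverse g)]"
  have "f = commutator x (commutator g (inverse y)) * commutator (commutator g (inverse z)) w"
    using Y(3,4) commutator_displaced(1)[OF _ _ D_in[OF g(2)] g(3), of x y]
      commutator_displaced(2)[OF _ _ D_in[OF g(2)] g(3), of z w] by auto
  also have "\<dots> = prod_list ?xs"
    by (simp add: commutator_def C_def mult.assoc)
  finally show ?thesis
    using Y(3) by (intro that[of ?xs])
      (auto intro!: conj intro: commutator_products_mult commutator_products_inverse)
qed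

theorem product_of_eight_conjugates:
  assumes "f \<in> D" "f \<noteq> 1" "c \<in> D" "c \<noteq> 1"
  obtains xs where "length xs = 8" "set xs \<subseteq> conjugates c \<union> conjugates (inverse c)" "f = prod_list xs"
proof -
  obtain W R where W: "W \<in> \<C>" "R \<in> \<C>" "W \<noteq> {}" "R \<noteq> {}" "app f ` W \<inter> W = {}"
    "R \<inter> (W \<union> app f ` W) = {}"
    using nontrivial_moves_clopen[OF D_in[OF assms(1)] assms(2)] .
  have fW: "app f ` W \<in> \<C>" using clopen_image[OF D_in[OF assms(1)] W(1)] .
  obtain R1 R2 where R: "R1 \<in> \<C>" "R2 \<in> \<C>" "R1 \<noteq> {}" "R2 \<noteq> {}" "R1 \<inter> R2 = {}" "R1 \<union> R2 = R"
    using clopen_split[OF W(2,4)] .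
  \<comment> \<open>\<open>R1\<close> is reserved for the correction into \<open>D\<close>; leaving
    out \<open>R2\<close> keeps \<open>Y\<close> proper, so that a conjugate of \<open>c\<close>
    displaces it.\<close>
  define Y where "Y = W \<union> app f ` W \<union> R1"
  have "Y \<in> \<C>" unfolding Y_def using W fW R by (simp add: clopen_union)
  have "Y \<noteq> X" using W(6) R clopen_subset[OF R(2)] unfolding Y_def by blast
  obtain t where t: "t \<in> rigid (W \<union> app f ` W)" "\<And>x. x \<in> W \<Longrightarrow> app t x = app f x"
    by (rule glue_swap[OF D_in[OF assms(1)] W(1,5)]) blast
  obtain k where k: "k \<in> rigid R1" "t * k \<in> D"
    using D_coset_rigid[OF rigidD(1)[OF t(1)] R(1,3)] .
  define a where "a = t * k"
  have aY: "a \<in> rigid Y" unfolding a_def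
    by (rule rigid_mult; rule rigid_mono[OF t(1)] rigid_mono[OF k(1)]) (auto simp: Y_def)
  have aW: "app a x = app f x" if "x \<in> W" for x
  proof -
    have "x \<notin> R1" using that W R by blast
    then show ?thesis using rigidD(2)[OF k(1)] t(2)[OF that] by (simp add: a_def supported_on_def)
  qed
  obtain g where g: "g \<in> conjugates c" "g \<in> D" "app g ` Y \<inter> Y = {}"
    using displacing_conjugate[OF assms(3,4) \<open>Y \<in> \<C>\<close> \<open>Y \<noteq> X\<close>] .
  \<comment> \<open>This is the commutator of \<open>a\<close> and \<open>g\<close>, a product of
    one conjugate of \<open>g\<close> and one inverse. On \<open>W\<close> it acts like
    \<open>a\<close>: \<open>inverse g\<close> moves \<open>W\<close> off \<open>Y\<close>, where
    \<open>inverse a\<close> is trivial, and \<open>g\<close> then brings the points back.\<close>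
  define q where "q = (a * g * inverse a) * inverse g"
  have qD: "q \<in> D" unfolding q_def
    using D_conjugate[OF g(2) rigidD(1)[OF aY]] commutator_products_inverse[OF g(2)]
    by (rule commutator_products_mult)
  have qW: "app q x = app f x" if x: "x \<in> W" for x
  proof -
    have "app (inverse g) x \<notin> Y"
    proof
      assume "app (inverse g) x \<in> Y"
      then have "x \<in> app g ` Y" by (simp add: in_image_app_iff)
      with g(3) x show False by (auto simp: Y_def)
    qed
    then have "app (inverse a) (app (inverse g) x) = app (inverse g) x"
      using rigidD(2)[OF rigid_inverse[OF aY]] by (simp add: supported_on_def)
    then show ?thesis using aW[OF x] by (simp add: q_def)
  qed
  define f' where "f' = inverse q * f"
  have f'D: "f' \<in> D" unfolding f'_def
    using commutator_products_inverse[OF qD] assms(1) by (rule commutator_products_mult)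
  have "app f' x = x" if "x \<notin> X - W" for x
  proof (cases "x \<in> W")
    case True
    then show ?thesis using qW by (simp add: f'_def app_inverse_eq_iff)
  next
    case False
    then show ?thesis using that supported[OF D_in[OF f'D]] by (simp add: supported_on_def)
  qed
  then have "f' \<in> rigid (X - W)" using D_in[OF f'D] by (simp add: rigid_def supported_on_def)
  moreover have "X - W \<in> \<C>" "X - W \<noteq> X" using W clopen_subset[OF W(1)] by (auto simp: clopen_compl)
  ultimately obtain xs where xs: "length xs = 6"
    "set xs \<subseteq> conjugates c \<union> conjugates (inverse c)" "f' = prod_list xs"
    using six_conjugates[OF f'D _ _ _ assms(3,4)] by metis
  show ?thesis
  proof (rule that)
    show "length ((a * g * inverse a) # inverse g # xs) = 8" using xs by simp
    show "f = prod_list ((a * g * inverse a) # inverse g # xs)"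
      by (simp add: xs(3)[symmetric] f'_def q_def mult.assoc)
    show "set ((a * g * inverse a) # inverse g # xs) \<subseteq> conjugates c \<union> conjugates (inverse c)"
      using xs(2) g(1) conjugates_conjugate[OF g(1), of a] k(2) conjugates_inverse[OF g(1)]
      by (simp add: a_def)
  qed
qed
end

section \<open>Rays and halftrees\<close>

text \<open>Finite paths without backtracks, encoded like rays by a function of which only the
  values up to \<open>n\<close> count. Initial segments of rays are thus paths without
  conversion.\<close>

definition nb_path :: "'v pair_pre_digraph \<Rightarrow> (nat \<Rightarrow> 'v) \<Rightarrow> nat \<Rightarrow> bool" where
  "nb_path T p n \<longleftrightarrow> (\<forall>i<n. (p i, p (Suc i)) \<in> parcs T) \<and> (\<forall>i. i + 2 \<le> n \<longrightarrow> p i \<noteq> p (i + 2))"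

lemma nb_path_shift: "nb_path T p n \<Longrightarrow> i + m \<le> n \<Longrightarrow> nb_path T (\<lambda>k. p (i + k)) m"
  by (auto simp: nb_path_def add.assoc[symmetric])

lemma is_ray_shift: "is_ray T r \<Longrightarrow> is_ray T (\<lambda>k. r (i + k))"
  by (auto simp: is_ray_def simp flip: add.assoc)

lemma nb_path_of_ray: "is_ray T r \<Longrightarrow> nb_path T r n"
  by (auto simp: nb_path_def is_ray_def)

text \<open>Translates vertex sequences into the arc lists in which cycles are expressed.\<close>

lemma pcas_map_walk: "i \<le> j \<Longrightarrow> pcas (q i) (map (\<lambda>k. (q k, q (Suc k))) [i..<j]) (q j)"
proof (induction "j - i" arbitrary: i)
  case (Suc d)
  then have "i < j" "pcas (q (Suc i)) (map (\<lambda>k. (q k, q (Suc k))) [Suc i..<j]) (q j)" by simp_all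
  then show ?case by (simp add: upt_conv_Cons)
qed simp

lemma pawalk_verts_map_walk:
  "i \<le> j \<Longrightarrow> pawalk_verts (q i) (map (\<lambda>k. (q k, q (Suc k))) [i..<j]) = map q [i..<Suc j]"
proof (induction "j - i" arbitrary: i)
  case (Suc d)
  then have "i < j"
    "pawalk_verts (q (Suc i)) (map (\<lambda>k. (q k, q (Suc k))) [Suc i..<j]) = map q [Suc i..<Suc j]"
    by simp_all
  then show ?case by (simp add: upt_conv_Cons[of i] del: upt_Suc)
qed simp

lemma cycle_mono:
  assumes "pre_digraph.cycle (with_proj S) p" "parcs S \<subseteq> parcs T" "pverts S \<subseteq> pverts T"
  shows "pre_digraph.cycle (with_proj T) p"
  using assms by (auto simp: pre_digraph.cycle_def pre_digraph.awalk_def cas_with_proj_eq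
      awalk_verts_with_proj_eq)

section \<open>Paths in a tree\<close>

locale tree_graph =
  fixes T :: "'v pair_pre_digraph"
  assumes tree: "is_tree T"
begin

abbreviation "E \<equiv> parcs T"
abbreviation "bd \<equiv> tree_boundary T"
abbreviation "H \<equiv> halftree_boundary T"

sublocale pair_bidirected_digraph T
  using tree by (simp add: is_tree_def)

lemma edge_sym: "(u, v) \<in> E \<Longrightarrow> (v, u) \<in> E"
  using pair_sym_arcs by (auto simp: symmetric_def dest: symD)

lemma swap_edge: "e \<in> E \<Longrightarrow> prod.swap e \<in> E"
  by (cases e) (simp add: edge_sym)

lemma no_loop: "(u, u) \<notin> E"
  using pair_no_loops by fastforce

lemma connected_rtrancl:
  assumes "u \<in> pverts T" "v \<in> pverts T"
  shows "(u, v) \<in> E\<^sup>*"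
proof -
  have "parcs (mk_symmetric (with_proj T)) = E"
    using edge_sym by (auto simp: mk_symmetric_def)
  moreover have "strongly_connected (with_proj (mk_symmetric (with_proj T)))"
    using tree by (simp add: is_tree_def Digraph_Component.connected_def)
  then have "reachable (with_proj (mk_symmetric (with_proj T))) u v"
    using assms by (simp add: strongly_connected_def mk_symmetric_def)
  then have "(u, v) \<in> (arcs_ends (with_proj (mk_symmetric (with_proj T))))\<^sup>*"
    by (rule reachable_rtranclI)
  ultimately show ?thesis by simp
qed

text \<open>A shortest closed segment has no repeated vertex apart from its two ends. Its length is
  not 1, as there are no loops, and not 2, as there is no backtrack, so it is a forbidden
  cycle.\<close>

lemma no_closed_nb_path:
  assumes "nb_path T p n" "0 < n"
  shows "p 0 \<noteq> p n"
proof
  assume "p 0 = p n"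
  define P where "P d \<longleftrightarrow> (\<exists>i. 0 < d \<and> i + d \<le> n \<and> p i = p (i + d))" for d
  have "P n" using assms \<open>p 0 = p n\<close> by (auto simp: P_def)
  define m where "m = (LEAST d. P d)"
  have "P m" unfolding m_def using \<open>P n\<close> by (rule LeastI)
  have least: "m \<le> d" if "P d" for d unfolding m_def using that by (rule Least_le)
  obtain i where i: "0 < m" "i + m \<le> n" "p i = p (i + m)" using \<open>P m\<close> by (auto simp: P_def)
  define q where "q k = p (i + k)" for k
  have q: "nb_path T q m" using nb_path_shift[OF assms(1) i(2)] by (simp add: q_def[abs_def])
  have closed: "q 0 = q m" using i by (simp add: q_def)
  have inj: "k = l" if "q k = q l" "k \<le> l" "l \<le> m" "0 < k" for k l
  proof (rule ccontr)
    assume "k \<noteq> l"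
    then have "P (l - k)" using that i(2) by (auto simp: P_def q_def intro!: exI[of _ "i + k"])
    with least[of "l - k"] that i(1) show False by simp
  qed
  have "m \<noteq> 1" using q closed no_loop by (auto simp: nb_path_def)
  moreover have "q 0 \<noteq> q 2" if "2 \<le> m" using q that unfolding nb_path_def by (metis add_0)
  then have "m \<noteq> 2" using closed by auto
  ultimately have "3 \<le> m" using i(1) by linarith
  let ?c = "map (\<lambda>k. (q k, q (Suc k))) [0..<m]"
  have "pre_digraph.cycle (with_proj T) ?c"
    unfolding pre_digraph.cycle_def
  proof (intro exI[of _ "q 0"] conjI)
    have "set ?c \<subseteq> E" using q by (auto simp: nb_path_def)
    moreover have "q 0 \<in> pverts T" using q i(1) in_arcsD1 by (auto simp: nb_path_def)
    ultimately show "pre_digraph.awalk (with_proj T) (q 0) ?c (q 0)"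
      using pcas_map_walk[of 0 m q] closed
      by (simp add: pre_digraph.awalk_def cas_with_proj_eq del: upt_Suc)
    have "pawalk_verts (q 0) ?c = map q [0..<Suc m]"
      using pawalk_verts_map_walk[of 0 m q] by simp
    then have "tl (pawalk_verts (q 0) ?c) = map q [1..<Suc m]"
      by (simp add: upt_conv_Cons[of 0 "Suc m"] del: upt_Suc)
    moreover have "inj_on q {1..<Suc m}"
    proof (rule inj_onI)
      fix k l assume "k \<in> {1..<Suc m}" "l \<in> {1..<Suc m}" "q k = q l"
      then show "k = l" using inj[of k l] inj[of l k] by (cases "k \<le> l") auto
    qed
    ultimately show "distinct (tl (pre_digraph.awalk_verts (with_proj T) (q 0) ?c))"
      by (simp add: awalk_verts_with_proj_eq distinct_map del: upt_Suc)
    show "?c \<noteq> []" using i(1) by simp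
  qed
  moreover have "3 \<le> length ?c" using \<open>3 \<le> m\<close> by simp
  ultimately show False using tree by (auto simp: is_tree_def)
qed

text \<open>Running back along \<open>p\<close> and on along \<open>q\<close> makes no backtrack at
  the common start, since the first steps differ; if the far ends met, this would be a closed
  path.\<close>

lemma no_merge:
  assumes "nb_path T p m" "nb_path T q n" "p 0 = q 0" "p 1 \<noteq> q 1" "0 < m" "0 < n"
  shows "p m \<noteq> q n"
proof
  assume eq: "p m = q n"
  define w where "w k = (if k \<le> m then p (m - k) else q (k - m))" for k
  have wq: "w (m + k) = q k" for k using assms(3) by (simp add: w_def)
  have "nb_path T w (m + n)"
    unfolding nb_path_def
  proof (intro conjI allI impI)
    fix i assume "i < m + n"
    show "(w i, w (Suc i)) \<in> E"
    proof (cases "i < m")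
      case True
      then have "(p (m - Suc i), p (Suc (m - Suc i))) \<in> E" using assms(1) by (simp add: nb_path_def)
      then show ?thesis using True by (simp add: w_def Suc_diff_Suc edge_sym)
    next
      case False
      then have "(q (i - m), q (Suc (i - m))) \<in> E"
        using assms(2) \<open>i < m + n\<close> by (simp add: nb_path_def)
      then show ?thesis using False wq[of "i - m"] wq[of "Suc (i - m)"] by simp
    qed
  next
    fix i assume i: "i + 2 \<le> m + n"
    consider "i + 2 \<le> m" | "i + 1 = m" | "m \<le> i" by linarith
    then show "w i \<noteq> w (i + 2)"
    proof cases
      case 1
      then have "p (m - (i + 2)) \<noteq> p (m - (i + 2) + 2)"
        using assms(1) by (simp add: nb_path_def)
      moreover have "m - (i + 2) + 2 = m - i" using 1 by simp
      ultimately show ?thesis using 1 by (simp add: w_def)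
    next
      case 2
      then show ?thesis using assms(4) by (auto simp: w_def)
    next
      case 3
      then have "q (i - m) \<noteq> q (i - m + 2)" using assms(2) i by (simp add: nb_path_def)
      then show ?thesis using 3 wq[of "i - m"] wq[of "i - m + 2"] by simp
    qed
  qed
  then have "w 0 \<noteq> w (m + n)" using assms(5) no_closed_nb_path by simp
  then show False using eq wq[of n] by (simp add: w_def)
qed

text \<open>Along a walk the path is either lengthened by the new vertex or, if that vertex is the
  previous one, shortened by its last step.\<close>

lemma exists_nb_path:
  assumes "u \<in> pverts T" "v \<in> pverts T"
  obtains p n where "nb_path T p n" "p 0 = u" "p n = v"
proof -
  have "(u, v) \<in> E\<^sup>*" using assms by (rule connected_rtrancl)
  then have "\<exists>p n. nb_path T p n \<and> p 0 = u \<and> p n = v"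
  proof (induction rule: rtrancl_induct)
    case base
    show ?case by (rule exI[of _ "\<lambda>_. u"], rule exI[of _ 0]) (simp add: nb_path_def)
  next
    case (step v w)
    then obtain p n where p: "nb_path T p n" "p 0 = u" "p n = v" by blast
    show ?case
    proof (cases "\<exists>m. n = Suc m \<and> p m = w")
      case True
      then obtain m where m: "n = Suc m" "p m = w" by blast
      have "nb_path T p m" using p(1) m(1) by (simp add: nb_path_def)
      with p m show ?thesis by blast
    next
      case False
      let ?q = "p(Suc n := w)"
      have "(?q i, ?q (Suc i)) \<in> E" if "i < Suc n" for i
        using that p step(2) by (cases "i = n") (auto simp: nb_path_def)
      moreover have "?q i \<noteq> ?q (i + 2)" if i: "i + 2 \<le> Suc n" for i
      proof (cases "i + 2 = Suc n")
        case True
        then have "n = Suc i" by simp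
        then show ?thesis using False by auto
      next
        case 2: False
        then have "i + 2 \<le> n" using i by simp
        then show ?thesis using p(1) by (simp add: nb_path_def)
      qed
      ultimately have "nb_path T ?q (Suc n)" unfolding nb_path_def by blast
      moreover have "?q 0 = u" "?q (Suc n) = w" using p(2) by simp_all
      ultimately show ?thesis by blast
    qed
  qed
  with that show ?thesis by blast
qed

section \<open>Ends and the rays representing them\<close>

lemma equiv_ray_equiv: "equiv (Collect (is_ray T)) (ray_equiv T)"
proof (rule equivI)
  show "refl_on (Collect (is_ray T)) (ray_equiv T)"
    by (auto simp: refl_on_def ray_equiv_def)
  show "sym (ray_equiv T)" by (auto simp: sym_def ray_equiv_def) metis+
  show "trans (ray_equiv T)"
  proof (rule transI)
    fix r s t assume "(r, s) \<in> ray_equiv T" "(s, t) \<in> ray_equiv T"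
    then obtain m n m' n' where rays: "is_ray T r" "is_ray T t"
      and eq: "\<And>k. r (m + k) = s (n + k)" "\<And>k. s (m' + k) = t (n' + k)"
      by (auto simp: ray_equiv_def)
    have "r (m + m' + k) = t (n' + n + k)" for k
      using eq(1)[of "m' + k"] eq(2)[of "n + k"] by (simp add: ac_simps)
    with rays show "(r, t) \<in> ray_equiv T" by (auto simp: ray_equiv_def)
  qed
qed (auto simp: ray_equiv_def)

lemma first_difference:
  fixes r s :: "nat \<Rightarrow> 'b"
  assumes "r 0 = s 0" "r \<noteq> s"
  shows "\<exists>i. r i = s i \<and> r (Suc i) \<noteq> s (Suc i)"
proof (rule ccontr)
  assume neg: "\<not> ?thesis"
  have "r i = s i" for i by (induction i) (use assms(1) neg in auto)
  then show False using assms(2) by blast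
qed

text \<open>Once they branch, two rays from the same vertex never meet again by
  \<open>no_merge\<close>, so they cannot have a common tail.\<close>

lemma equivalent_rays_eq:
  assumes "(r, s) \<in> ray_equiv T" "r 0 = s 0"
  shows "r = s"
proof (rule ccontr)
  assume "r \<noteq> s"
  obtain m n where rs: "is_ray T r" "is_ray T s" "\<And>k. r (m + k) = s (n + k)"
    using assms by (auto simp: ray_equiv_def)
  obtain i where i: "r i = s i" "r (Suc i) \<noteq> s (Suc i)"
    using first_difference[OF assms(2) \<open>r \<noteq> s\<close>] by blast
  have "r (i + (m + 1)) \<noteq> s (i + (n + 1))"
    using no_merge[of "\<lambda>k. r (i + k)" "m + 1" "\<lambda>k. s (i + k)" "n + 1"]
      nb_path_of_ray[OF is_ray_shift[OF rs(1)]] nb_path_of_ray[OF is_ray_shift[OF rs(2)]] i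
    by simp
  moreover have "r (m + (i + 1)) = s (n + (i + 1))" by (rule rs(3))
  ultimately show False by (simp add: ac_simps)
qed

lemma bd_cases:
  assumes "\<xi> \<in> bd"
  obtains r where "is_ray T r" "\<xi> = ray_equiv T `` {r}"
  using assms by (auto simp: tree_boundary_def elim: quotientE)

lemma class_in_bd: "is_ray T r \<Longrightarrow> ray_equiv T `` {r} \<in> bd"
  by (simp add: tree_boundary_def quotientI)

lemma class_eq_iff: "is_ray T r \<Longrightarrow> is_ray T s \<Longrightarrow>
    ray_equiv T `` {r} = ray_equiv T `` {s} \<longleftrightarrow> (r, s) \<in> ray_equiv T"
  by (rule eq_equiv_class_iff[OF equiv_ray_equiv]) simp_all

lemma ray_equiv_shift: "is_ray T r \<Longrightarrow> (r, \<lambda>k. r (i + k)) \<in> ray_equiv T"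
  using is_ray_shift[of T r i] unfolding ray_equiv_def mem_Collect_eq case_prod_conv
  by (intro conjI exI[of _ i] exI[of _ 0]) simp_all

lemma ray_equiv_Suc: "is_ray T r \<Longrightarrow> (r, \<lambda>k. r (Suc k)) \<in> ray_equiv T"
  using ray_equiv_shift[of r 1] by simp

lemma ray_equiv_trans: "(r, s) \<in> ray_equiv T \<Longrightarrow> (s, t) \<in> ray_equiv T \<Longrightarrow> (r, t) \<in> ray_equiv T"
  using equiv_ray_equiv by (auto simp: equiv_def dest: transD)

lemma ray_equiv_sym: "(r, s) \<in> ray_equiv T \<Longrightarrow> (s, r) \<in> ray_equiv T"
  using equiv_ray_equiv by (auto simp: equiv_def dest: symD)

lemma ray_in_verts: "is_ray T r \<Longrightarrow> r n \<in> pverts T"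
  using in_arcsD1 by (auto simp: is_ray_def)

lemma prepend_ray:
  assumes "is_ray T r" "(v, r 0) \<in> E" "r 1 \<noteq> v"
  shows "is_ray T (case_nat v r)" "(r, case_nat v r) \<in> ray_equiv T"
proof -
  show *: "is_ray T (case_nat v r)"
    unfolding is_ray_def
  proof (intro conjI allI)
    fix n show "(case_nat v r n, case_nat v r (Suc n)) \<in> E"
      using assms by (cases n) (auto simp: is_ray_def)
    show "case_nat v r n \<noteq> case_nat v r (n + 2)"
      using assms by (cases n) (auto simp: is_ray_def)
  qed
  show "(r, case_nat v r) \<in> ray_equiv T"
    using ray_equiv_sym[OF ray_equiv_Suc[OF *]] by simp
qed

text \<open>The base point is moved along one edge at a time: a ray starting with that edge loses
  its first vertex, any other ray gets the new vertex in front.\<close>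

lemma ray_towards:
  assumes "is_ray T r" "v \<in> pverts T"
  shows "\<exists>s. (r, s) \<in> ray_equiv T \<and> s 0 = v"
proof -
  have "(r 0, v) \<in> E\<^sup>*" using assms ray_in_verts by (blast intro: connected_rtrancl)
  then show ?thesis
  proof (induction rule: rtrancl_induct)
    case base
    have "(r, r) \<in> ray_equiv T" using assms by (auto simp: ray_equiv_def)
    then show ?case by blast
  next
    case (step v w)
    then obtain s where s: "(r, s) \<in> ray_equiv T" "s 0 = v" by blast
    then have "is_ray T s" by (simp add: ray_equiv_def)
    show ?case
    proof (cases "s 1 = w")
      case True
      then show ?thesis
        using ray_equiv_trans[OF s(1) ray_equiv_Suc[OF \<open>is_ray T s\<close>]]
        by (intro exI[of _ "\<lambda>k. s (Suc k)"]) simp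
    next
      case False
      then show ?thesis
        using ray_equiv_trans[OF s(1) prepend_ray(2)[OF \<open>is_ray T s\<close>]] s(2) edge_sym step(2)
        by (intro exI[of _ "case_nat w s"]) simp
    qed
  qed
qed

text \<open>For an end and a vertex the choice is unique by \<open>equivalent_rays_eq\<close>, which
  turns questions about ends into questions about the first steps of rays.\<close>

definition ray_from :: "'v \<Rightarrow> (nat \<Rightarrow> 'v) set \<Rightarrow> nat \<Rightarrow> 'v" where
  "ray_from v \<xi> = (SOME r. r \<in> \<xi> \<and> r 0 = v)"

lemma ray_from:
  assumes "\<xi> \<in> bd" "v \<in> pverts T"
  shows "is_ray T (ray_from v \<xi>)" "ray_from v \<xi> \<in> \<xi>" "ray_from v \<xi> 0 = v"
    "ray_equiv T `` {ray_from v \<xi>} = \<xi>"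
proof -
  obtain r where r: "is_ray T r" "\<xi> = ray_equiv T `` {r}" using assms(1) by (rule bd_cases)
  then have "\<exists>s. s \<in> \<xi> \<and> s 0 = v" using ray_towards[OF r(1) assms(2)] by simp
  then have *: "ray_from v \<xi> \<in> \<xi> \<and> ray_from v \<xi> 0 = v"
    unfolding ray_from_def by (rule someI_ex)
  then show "ray_from v \<xi> \<in> \<xi>" "ray_from v \<xi> 0 = v" by simp_all
  from * r show "is_ray T (ray_from v \<xi>)" by (auto simp: ray_equiv_def)
  then show "ray_equiv T `` {ray_from v \<xi>} = \<xi>"
    using * r class_eq_iff ray_equiv_sym by auto
qed

lemma ray_from_eqI:
  assumes "is_ray T r" "ray_equiv T `` {r} = \<xi>" "r 0 = v"
  shows "ray_from v \<xi> = r"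
proof -
  have "\<xi> \<in> bd" "v \<in> pverts T" using assms class_in_bd ray_in_verts by metis+
  then show ?thesis
    using ray_from[of \<xi> v] assms class_eq_iff by (intro equivalent_rays_eq) auto
qed

section \<open>Halftrees in the boundary\<close>

lemma H_iff:
  assumes "(a, b) \<in> E"
  shows "\<xi> \<in> H (a, b) \<longleftrightarrow> \<xi> \<in> bd \<and> ray_from a \<xi> 1 = b"
proof
  assume "\<xi> \<in> H (a, b)"
  then obtain r where "is_ray T r" "\<xi> = ray_equiv T `` {r}" "r 0 = a" "r 1 = b"
    by (auto simp: halftree_boundary_def)
  then show "\<xi> \<in> bd \<and> ray_from a \<xi> 1 = b" using class_in_bd ray_from_eqI by metis
next
  assume *: "\<xi> \<in> bd \<and> ray_from a \<xi> 1 = b"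
  then show "\<xi> \<in> H (a, b)"
    using ray_from[of \<xi> a] in_arcsD1[OF assms]
    unfolding halftree_boundary_def by (auto intro!: exI[of _ "ray_from a \<xi>"])
qed

lemma H_subset: "e \<in> E \<Longrightarrow> H e \<subseteq> bd"
  by (cases e) (auto simp: H_iff)

lemma H_same_tail: "(a, b) \<in> E \<Longrightarrow> (a, c) \<in> E \<Longrightarrow> b \<noteq> c \<Longrightarrow> H (a, b) \<inter> H (a, c) = {}"
  by (auto simp: H_iff)

text \<open>The rays from \<open>a\<close> and from \<open>b\<close> to one end differ by a single
  vertex: either the ray from \<open>a\<close> passes through \<open>b\<close>, or the ray from
  \<open>b\<close> passes through \<open>a\<close>, and never both.\<close>

lemma H_swap:
  assumes "(a, b) \<in> E"
  shows "H (b, a) = bd - H (a, b)"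
proof -
  have "\<xi> \<in> H (b, a) \<longleftrightarrow> \<xi> \<notin> H (a, b)" if \<xi>: "\<xi> \<in> bd" for \<xi>
  proof -
    have ab: "a \<in> pverts T" "b \<in> pverts T" using assms in_arcsD1 in_arcsD2 by auto
    note ra = ray_from[OF \<xi> ab(1)]
    show ?thesis
    proof (cases "ray_from a \<xi> 1 = b")
      case True
      have "ray_from b \<xi> = (\<lambda>k. ray_from a \<xi> (Suc k))"
        using is_ray_shift[OF ra(1), of 1] ray_equiv_Suc[OF ra(1)] ra True
        by (intro ray_from_eqI) (auto simp: class_eq_iff[symmetric])
      moreover have "ray_from a \<xi> (Suc 1) \<noteq> a" using ra(1,3) by (metis Suc_1 add_0 is_ray_def)
      ultimately show ?thesis using True \<xi> assms edge_sym by (simp add: H_iff)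
    next
      case False
      have "ray_from b \<xi> = case_nat b (ray_from a \<xi>)"
        using prepend_ray[OF ra(1), of b] ra False edge_sym[OF assms]
        by (intro ray_from_eqI) (auto simp: class_eq_iff[symmetric])
      then show ?thesis using False \<xi> assms edge_sym ra(3) by (simp add: H_iff)
    qed
  qed
  then show ?thesis using H_subset assms edge_sym by blast
qed

lemma H_prod_swap: "e \<in> E \<Longrightarrow> H (prod.swap e) = bd - H e"
  by (cases e) (simp add: H_swap)

lemma H_step:
  assumes "(a, b) \<in> E" "(b, c) \<in> E" "a \<noteq> c"
  shows "H (b, c) \<subseteq> H (a, b)"
  using H_same_tail[of b c a] assms edge_sym H_swap[OF assms(1)] H_subset[OF assms(2)] by blast

lemma H_path_antimono:
  assumes "nb_path T p n" "i \<le> j" "j < n"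
  shows "H (p j, p (Suc j)) \<subseteq> H (p i, p (Suc i))"
  using assms(2,3)
proof (induction rule: dec_induct)
  case (step j)
  have "H (p (Suc j), p (Suc (Suc j))) \<subseteq> H (p j, p (Suc j))"
    using assms(1) step by (intro H_step) (auto simp: nb_path_def)
  with step show ?case by auto
qed simp

text \<open>Either \<open>w\<close> continues the path, or it is the vertex before the last and the
  reversed edge is the last edge of the path. This is what later makes certain sets of edges
  convex.\<close>

lemma H_end_edge:
  assumes "nb_path T p n" "i < n" "(p n, w) \<in> E"
  shows "H (p n, w) \<subseteq> H (p i, p (Suc i)) \<or> H (w, p n) \<subseteq> H (p i, p (Suc i))"
proof -
  obtain m where m: "n = Suc m" using assms(2) by (cases n) auto
  have sub: "H (p m, p n) \<subseteq> H (p i, p (Suc i))"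
    using H_path_antimono[OF assms(1), of i m] assms(2) m by simp
  show ?thesis
  proof (cases "w = p m")
    case True
    with sub show ?thesis by simp
  next
    case False
    have "(p m, p n) \<in> E" using assms(1) m by (simp add: nb_path_def)
    then have "H (p n, w) \<subseteq> H (p m, p n)" using H_step[OF _ assms(3)] False by blast
    with sub show ?thesis by blast
  qed
qed

section \<open>Topology of the boundary\<close>

lemma topspace_boundary: "topspace (boundary_topology T) = bd"
proof -
  have "\<xi> \<in> \<Union>(H ` E)" if "\<xi> \<in> bd" for \<xi>
  proof -
    obtain r where r: "is_ray T r" "\<xi> = ray_equiv T `` {r}" using \<open>\<xi> \<in> bd\<close> by (rule bd_cases)
    then have "\<xi> \<in> H (r 0, r 1)" "(r 0, r 1) \<in> E"
      by (auto simp: halftree_boundary_def is_ray_def)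
    then show ?thesis by blast
  qed
  moreover have "topspace (boundary_topology T) = \<Union>(H ` E)"
    unfolding boundary_topology_def by (rule topology_generated_by_topspace)
  ultimately show ?thesis using H_subset by blast
qed

lemma openin_H: "e \<in> E \<Longrightarrow> openin (boundary_topology T) (H e)"
  unfolding boundary_topology_def by (rule topology_generated_by_Basis) simp

lemma closedin_H: "e \<in> E \<Longrightarrow> closedin (boundary_topology T) (H e)"
  using openin_H[OF swap_edge] H_subset H_prod_swap
  by (simp add: closedin_def topspace_boundary)

lemma class_in_H:
  assumes "is_ray T r"
  shows "ray_equiv T `` {r} \<in> H (r m, r (Suc m))"
proof -
  have "ray_equiv T `` {r} = ray_equiv T `` {\<lambda>k. r (m + k)}"
    using ray_equiv_shift[OF assms] class_eq_iff[OF assms is_ray_shift[OF assms]] by simp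
  then show ?thesis using is_ray_shift[OF assms, of m]
    by (auto simp: halftree_boundary_def intro!: exI[of _ "\<lambda>k. r (m + k)"])
qed

lemma ends_separated:
  assumes "\<xi> \<in> bd" "\<eta> \<in> bd" "\<xi> \<noteq> \<eta>"
  shows "\<exists>e\<in>E. \<xi> \<in> H e \<and> \<eta> \<notin> H e"
proof -
  obtain r where r: "is_ray T r" "\<xi> = ray_equiv T `` {r}" using assms(1) by (rule bd_cases)
  define s where "s = ray_from (r 0) \<eta>"
  have s: "is_ray T s" "\<eta> = ray_equiv T `` {s}" "r 0 = s 0"
    using ray_from[OF assms(2) ray_in_verts[OF r(1)]] by (simp_all add: s_def)
  then obtain i where i: "r i = s i" "r (Suc i) \<noteq> s (Suc i)"
    using first_difference[of r s] r(2) assms(3) by blast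
  have "(r i, r (Suc i)) \<in> E" "(s i, s (Suc i)) \<in> E" using r(1) s(1) by (simp_all add: is_ray_def)
  then show ?thesis
    using H_same_tail[of "r i" "r (Suc i)" "s (Suc i)"] i class_in_H[OF r(1), of i]
      class_in_H[OF s(1), of i] r(2) s(2) by auto
qed

lemma halftree_nbhd:
  assumes "openin (boundary_topology T) U" "\<xi> \<in> U"
  shows "\<exists>e\<in>E. \<xi> \<in> H e \<and> H e \<subseteq> U"
proof -
  have "\<xi> \<in> bd" using openin_subset[OF assms(1)] assms(2) topspace_boundary by blast
  then obtain r where r: "is_ray T r" "\<xi> = ray_equiv T `` {r}" by (rule bd_cases)
  have rE: "(r m, r (Suc m)) \<in> E" for m using r(1) by (simp add: is_ray_def)
  have \<xi>H: "\<xi> \<in> H (r m, r (Suc m))" for m using class_in_H[OF r(1)] r(2) by simp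
  have "generate_topology_on (H ` E) U"
    using assms(1) unfolding boundary_topology_def by (rule openin_topology_generated_by)
  \<comment> \<open>Strengthened for the induction: all but finitely many halftrees along the ray
    lie in \<open>U\<close>. In this form the claim survives finite intersections.\<close>
  then have "\<xi> \<in> U \<longrightarrow> (\<exists>N. \<forall>m\<ge>N. H (r m, r (Suc m)) \<subseteq> U)"
  proof (induction rule: generate_topology_on.induct)
    case (Int U V)
    show ?case
    proof
      assume "\<xi> \<in> U \<inter> V"
      with Int obtain M N where "\<forall>m\<ge>M. H (r m, r (Suc m)) \<subseteq> U" "\<forall>m\<ge>N. H (r m, r (Suc m)) \<subseteq> V"
        by blast
      then show "\<exists>N. \<forall>m\<ge>N. H (r m, r (Suc m)) \<subseteq> U \<inter> V" by (intro exI[of _ "max M N"]) auto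
    qed
  next
    case (UN K)
    then show ?case by (meson Sup_upper UnionE order_trans)
  next
    case (Basis U)
    show ?case
    proof
      assume "\<xi> \<in> U"
      with Basis obtain a b where ab: "(a, b) \<in> E" "U = H (a, b)" "\<xi> \<in> H (a, b)" by auto
      then obtain s where s: "is_ray T s" "\<xi> = ray_equiv T `` {s}" "s 0 = a" "s 1 = b"
        by (auto simp: halftree_boundary_def)
      then have "(r, s) \<in> ray_equiv T" using r class_eq_iff by metis
      then obtain m n where mn: "\<And>k. r (m + k) = s (n + k)" by (auto simp: ray_equiv_def)
      have "H (r l, r (Suc l)) \<subseteq> U" if "m \<le> l" for l
      proof -
        obtain k where k: "l = m + k" using \<open>m \<le> l\<close> le_Suc_ex by blast
        have "H (r l, r (Suc l)) = H (s (n + k), s (Suc (n + k)))"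
          using mn[of k] mn[of "Suc k"] by (simp add: k)
        also have "\<dots> \<subseteq> H (s 0, s (Suc 0))"
          by (rule H_path_antimono[OF nb_path_of_ray[OF s(1), of "Suc (n + k)"]]) auto
        finally show ?thesis using ab s by simp
      qed
      then show "\<exists>N. \<forall>m\<ge>N. H (r m, r (Suc m)) \<subseteq> U" by blast
    qed
  qed simp
  then obtain N where "H (r N, r (Suc N)) \<subseteq> U" using assms(2) by blast
  then show ?thesis using rE \<xi>H by blast
qed

end

section \<open>Dynamics on the boundary\<close>

locale tree_action = tree_graph T
  for \<Gamma> :: "('g, 'm) monoid_scheme" and T :: "'v pair_pre_digraph" and \<phi> :: "'g \<Rightarrow> 'v \<Rightarrow> 'v" +
  assumes action: "acts_on_tree \<Gamma> T \<phi>"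
begin

section \<open>Translates of ends and halftrees\<close>

sublocale vertices: group_action \<Gamma> "pverts T" \<phi>
  using action by (simp add: acts_on_tree_def)

sublocale acting: group \<Gamma>
  using vertices.group_hom by (simp add: group_hom_def)

abbreviation "\<alpha> \<equiv> boundary_action T \<phi>"
abbreviation "tr g \<equiv> map_prod (\<phi> g) (\<phi> g)"

lemma vertex_in: "g \<in> carrier \<Gamma> \<Longrightarrow> v \<in> pverts T \<Longrightarrow> \<phi> g v \<in> pverts T"
  using vertices.element_image by blast

lemma vertex_one: "v \<in> pverts T \<Longrightarrow> \<phi> \<one>\<^bsub>\<Gamma>\<^esub> v = v"
  by (simp flip: vertices.id_eq_one)

lemma vertex_inv:
  "g \<in> carrier \<Gamma> \<Longrightarrow> v \<in> pverts T \<Longrightarrow> \<phi> (inv\<^bsub>\<Gamma>\<^esub> g) (\<phi> g v) = v"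
  "g \<in> carrier \<Gamma> \<Longrightarrow> v \<in> pverts T \<Longrightarrow> \<phi> g (\<phi> (inv\<^bsub>\<Gamma>\<^esub> g) v) = v"
  using vertices.orbit_sym_aux[of g v] vertices.orbit_sym_aux[of "inv\<^bsub>\<Gamma>\<^esub> g" v] by auto

lemma vertex_inj: "g \<in> carrier \<Gamma> \<Longrightarrow> u \<in> pverts T \<Longrightarrow> v \<in> pverts T \<Longrightarrow> \<phi> g u = \<phi> g v \<longleftrightarrow> u = v"
  by (metis vertex_inv(1))

lemma edge_tr: "g \<in> carrier \<Gamma> \<Longrightarrow> e \<in> E \<Longrightarrow> tr g e \<in> E"
  using action in_arcsD1 in_arcsD2 by (cases e) (auto simp: acts_on_tree_def)

lemma edge_verts: "e \<in> E \<Longrightarrow> fst e \<in> pverts T" "e \<in> E \<Longrightarrow> snd e \<in> pverts T"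
  by (rule arc_fst_in_verts arc_snd_in_verts; assumption)+

lemma tr_mult: "g \<in> carrier \<Gamma> \<Longrightarrow> h \<in> carrier \<Gamma> \<Longrightarrow> e \<in> E \<Longrightarrow> tr (g \<otimes>\<^bsub>\<Gamma>\<^esub> h) e = tr g (tr h e)"
  using edge_verts[of e] by (cases e) (simp add: vertices.composition_rule)

lemma tr_one: "e \<in> E \<Longrightarrow> tr \<one>\<^bsub>\<Gamma>\<^esub> e = e"
  using edge_verts[of e] by (cases e) (simp add: vertex_one)

lemma tr_inv:
  "g \<in> carrier \<Gamma> \<Longrightarrow> e \<in> E \<Longrightarrow> tr (inv\<^bsub>\<Gamma>\<^esub> g) (tr g e) = e"
  "g \<in> carrier \<Gamma> \<Longrightarrow> e \<in> E \<Longrightarrow> tr g (tr (inv\<^bsub>\<Gamma>\<^esub> g) e) = e"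
  using edge_verts[of e] by (cases e; simp add: vertex_inv)+

lemma tr_swap: "tr g (prod.swap e) = prod.swap (tr g e)"
  by (cases e) simp

lemma ray_tr: "g \<in> carrier \<Gamma> \<Longrightarrow> is_ray T r \<Longrightarrow> is_ray T (\<phi> g \<circ> r)"
  using edge_tr[of g "(r n, r (Suc n))" for n] vertex_inj ray_in_verts
  by (auto simp: is_ray_def)

lemma ray_equiv_tr:
  "g \<in> carrier \<Gamma> \<Longrightarrow> (r, s) \<in> ray_equiv T \<Longrightarrow> (\<phi> g \<circ> r, \<phi> g \<circ> s) \<in> ray_equiv T"
  by (auto simp: ray_equiv_def ray_tr) metis

lemma ray_inv: "g \<in> carrier \<Gamma> \<Longrightarrow> is_ray T r \<Longrightarrow> \<phi> g \<circ> (\<phi> (inv\<^bsub>\<Gamma>\<^esub> g) \<circ> r) = r"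
  using ray_in_verts by (auto simp: fun_eq_iff vertex_inv)

lemma boundary_action_class:
  assumes g: "g \<in> carrier \<Gamma>" and r: "is_ray T r"
  shows "\<alpha> g (ray_equiv T `` {r}) = ray_equiv T `` {\<phi> g \<circ> r}"
proof -
  have "(\<lambda>r. \<phi> g \<circ> r) ` (ray_equiv T `` {r}) = ray_equiv T `` {\<phi> g \<circ> r}"
  proof (intro equalityI subsetI)
    fix s assume "s \<in> ray_equiv T `` {\<phi> g \<circ> r}"
    then have s: "(\<phi> g \<circ> r, s) \<in> ray_equiv T" "is_ray T s" by (auto simp: ray_equiv_def)
    have "\<phi> (inv\<^bsub>\<Gamma>\<^esub> g) \<circ> (\<phi> g \<circ> r) = r"
      using ray_inv[of "inv\<^bsub>\<Gamma>\<^esub> g" r] g r by simp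
    then have "(r, \<phi> (inv\<^bsub>\<Gamma>\<^esub> g) \<circ> s) \<in> ray_equiv T"
      using ray_equiv_tr[OF _ s(1), of "inv\<^bsub>\<Gamma>\<^esub> g"] g by simp
    then show "s \<in> (\<lambda>r. \<phi> g \<circ> r) ` (ray_equiv T `` {r})"
      using ray_inv[OF g s(2)] by (metis ImageI imageI singletonI)
  qed (auto intro: ray_equiv_tr[OF g])
  then show ?thesis using class_in_bd[OF r] by (simp add: boundary_action_def)
qed

lemma \<alpha>_in: "g \<in> carrier \<Gamma> \<Longrightarrow> \<xi> \<in> bd \<Longrightarrow> \<alpha> g \<xi> \<in> bd"
  by (metis bd_cases boundary_action_class class_in_bd ray_tr)

lemma \<alpha>_mult:
  assumes "g \<in> carrier \<Gamma>" "h \<in> carrier \<Gamma>" "\<xi> \<in> bd"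
  shows "\<alpha> (g \<otimes>\<^bsub>\<Gamma>\<^esub> h) \<xi> = \<alpha> g (\<alpha> h \<xi>)"
proof -
  obtain r where r: "is_ray T r" "\<xi> = ray_equiv T `` {r}" using assms(3) by (rule bd_cases)
  have "\<phi> (g \<otimes>\<^bsub>\<Gamma>\<^esub> h) \<circ> r = \<phi> g \<circ> (\<phi> h \<circ> r)"
    using ray_in_verts[OF r(1)] assms by (simp add: fun_eq_iff vertices.composition_rule)
  then show ?thesis using assms r by (simp add: boundary_action_class ray_tr)
qed

lemma \<alpha>_one: "\<xi> \<in> bd \<Longrightarrow> \<alpha> \<one>\<^bsub>\<Gamma>\<^esub> \<xi> = \<xi>"
proof -
  assume "\<xi> \<in> bd"
  then obtain r where r: "is_ray T r" "\<xi> = ray_equiv T `` {r}" by (rule bd_cases)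
  have "\<phi> \<one>\<^bsub>\<Gamma>\<^esub> \<circ> r = r" using ray_in_verts[OF r(1)] by (simp add: fun_eq_iff vertex_one)
  then show ?thesis using r by (simp add: boundary_action_class)
qed

lemma \<alpha>_inv:
  "g \<in> carrier \<Gamma> \<Longrightarrow> \<xi> \<in> bd \<Longrightarrow> \<alpha> (inv\<^bsub>\<Gamma>\<^esub> g) (\<alpha> g \<xi>) = \<xi>"
  "g \<in> carrier \<Gamma> \<Longrightarrow> \<xi> \<in> bd \<Longrightarrow> \<alpha> g (\<alpha> (inv\<^bsub>\<Gamma>\<^esub> g) \<xi>) = \<xi>"
  using \<alpha>_mult[of "inv\<^bsub>\<Gamma>\<^esub> g" g \<xi>] \<alpha>_mult[of g "inv\<^bsub>\<Gamma>\<^esub> g" \<xi>] \<alpha>_one by simp_all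

lemma H_tr:
  assumes "g \<in> carrier \<Gamma>" "e \<in> E" "\<xi> \<in> H e"
  shows "\<alpha> g \<xi> \<in> H (tr g e)"
proof -
  obtain r where r: "is_ray T r" "\<xi> = ray_equiv T `` {r}" "r 0 = fst e" "r 1 = snd e"
    using assms(3) by (auto simp: halftree_boundary_def)
  then have "\<alpha> g \<xi> = ray_equiv T `` {\<phi> g \<circ> r}" "is_ray T (\<phi> g \<circ> r)"
    "(\<phi> g \<circ> r) 0 = fst (tr g e)" "(\<phi> g \<circ> r) 1 = snd (tr g e)"
    using assms(1) by (simp_all add: boundary_action_class ray_tr)
  then show ?thesis unfolding halftree_boundary_def by blast
qed

lemma H_tr_iff: "g \<in> carrier \<Gamma> \<Longrightarrow> e \<in> E \<Longrightarrow> \<xi> \<in> bd \<Longrightarrow> \<alpha> g \<xi> \<in> H (tr g e) \<longleftrightarrow> \<xi> \<in> H e"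
  using H_tr[of g e \<xi>] H_tr[of "inv\<^bsub>\<Gamma>\<^esub> g" "tr g e" "\<alpha> g \<xi>"] by (auto simp: \<alpha>_inv tr_inv edge_tr)

lemma H_tr_mono:
  assumes "g \<in> carrier \<Gamma>" "e \<in> E" "f \<in> E" "H e \<subseteq> H f"
  shows "H (tr g e) \<subseteq> H (tr g f)"
proof
  fix \<xi> assume \<xi>: "\<xi> \<in> H (tr g e)"
  then have "\<xi> \<in> bd" using H_subset[OF edge_tr[OF assms(1,2)]] by blast
  define \<eta> where "\<eta> = \<alpha> (inv\<^bsub>\<Gamma>\<^esub> g) \<xi>"
  have \<eta>: "\<eta> \<in> bd" "\<alpha> g \<eta> = \<xi>" using \<open>\<xi> \<in> bd\<close> assms(1) by (simp_all add: \<eta>_def \<alpha>_in \<alpha>_inv)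
  then have "\<eta> \<in> H f" using H_tr_iff[OF assms(1,2) \<eta>(1)] \<xi> assms(4) by blast
  then show "\<xi> \<in> H (tr g f)" using H_tr[OF assms(1,3)] \<eta>(2) by blast
qed

text \<open>A preorder on oriented edges, invariant under \<open>\<Gamma>\<close> in both arguments
  and reversed by swapping orientations. Extreme proximality amounts to any two edges being
  related.\<close>

definition shrinks :: "'v \<times> 'v \<Rightarrow> 'v \<times> 'v \<Rightarrow> bool" where
  "shrinks e f \<longleftrightarrow> (\<exists>g\<in>carrier \<Gamma>. H (tr g e) \<subseteq> H f)"

lemma shrinks_mono: "e \<in> E \<Longrightarrow> e' \<in> E \<Longrightarrow> H e' \<subseteq> H e \<Longrightarrow> shrinks e f \<Longrightarrow> shrinks e' f"
  unfolding shrinks_def by (meson H_tr_mono order_trans)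

lemma shrinks_subset: "e \<in> E \<Longrightarrow> H e \<subseteq> H f \<Longrightarrow> shrinks e f"
  unfolding shrinks_def by (rule bexI[of _ "\<one>\<^bsub>\<Gamma>\<^esub>"]) (simp_all add: tr_one)

lemma shrinks_trans:
  assumes "e \<in> E" "f \<in> E" "d \<in> E" "shrinks e f" "shrinks f d"
  shows "shrinks e d"
proof -
  obtain g h where g: "g \<in> carrier \<Gamma>" "H (tr g e) \<subseteq> H f" and h: "h \<in> carrier \<Gamma>" "H (tr h f) \<subseteq> H d"
    using assms by (auto simp: shrinks_def)
  have "H (tr (h \<otimes>\<^bsub>\<Gamma>\<^esub> g) e) \<subseteq> H d"
    using H_tr_mono[OF h(1) edge_tr[OF g(1) assms(1)] assms(2) g(2)] h g assms(1)
    by (simp add: tr_mult)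
  then show ?thesis using acting.m_closed[OF h(1) g(1)] unfolding shrinks_def by blast
qed

lemma shrinks_tr:
  assumes "g \<in> carrier \<Gamma>" "e \<in> E" "f \<in> E"
  shows "shrinks (tr g e) f \<longleftrightarrow> shrinks e f" "shrinks e (tr g f) \<longleftrightarrow> shrinks e f"
proof -
  have 1: "shrinks (tr g d) d" if "d \<in> E" for d
    unfolding shrinks_def using assms(1) that
    by (intro bexI[of _ "inv\<^bsub>\<Gamma>\<^esub> g"]) (simp_all add: tr_inv)
  have 2: "shrinks d (tr g d)" for d
    unfolding shrinks_def using assms(1) by blast
  have E: "tr g e \<in> E" "tr g f \<in> E" using assms edge_tr by auto
  show "shrinks (tr g e) f \<longleftrightarrow> shrinks e f"
    using shrinks_trans[OF assms(2) E(1) assms(3) 2] shrinks_trans[OF E(1) assms(2,3) 1[OF assms(2)]]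
    by (rule iffI)
  show "shrinks e (tr g f) \<longleftrightarrow> shrinks e f"
    using shrinks_trans[OF assms(2) E(2) assms(3) _ 1[OF assms(3)]]
      shrinks_trans[OF assms(2,3) E(2) _ 2]
    by (rule iffI)
qed

text \<open>Take complements in the inclusion of halftrees, then undo the translation.\<close>

lemma shrinks_swap:
  assumes "e \<in> E" "f \<in> E" "shrinks e f"
  shows "shrinks (prod.swap f) (prod.swap e)"
proof -
  obtain g where g: "g \<in> carrier \<Gamma>" "H (tr g e) \<subseteq> H f" using assms by (auto simp: shrinks_def)
  have "H (prod.swap f) \<subseteq> H (tr g (prod.swap e))"
    using g assms edge_tr[OF g(1) assms(1)] by (auto simp: tr_swap H_prod_swap)
  then have "shrinks (prod.swap f) (tr g (prod.swap e))"
    using assms swap_edge shrinks_subset by blast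
  then show ?thesis using shrinks_tr(2) g assms swap_edge by blast
qed

end

section \<open>From minimality to extreme proximality\<close>

locale minimal_tree_action = tree_action \<Gamma> T \<phi>
  for \<Gamma> :: "('g, 'm) monoid_scheme" and T :: "'v pair_pre_digraph" and \<phi> :: "'g \<Rightarrow> 'v \<Rightarrow> 'v" +
  assumes minimal: "subtree S T \<Longrightarrow> invariant_subgraph \<Gamma> \<phi> S \<Longrightarrow> S = T"
    and no_fixed_end: "\<xi> \<in> bd \<Longrightarrow> \<exists>g\<in>carrier \<Gamma>. \<alpha> g \<xi> \<noteq> \<xi>"
begin

text \<open>The edges without a translate, in either orientation, pointing into the halftree of \<open>f\<close> span
  an invariant subtree missing \<open>f\<close>.\<close>

lemma shrinks_or_swap:
  assumes "e \<in> E" "f \<in> E"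
  shows "shrinks e f \<or> shrinks (prod.swap e) f"
proof (rule ccontr)
  assume neg: "\<not> (shrinks e f \<or> shrinks (prod.swap e) f)"
  define F where "F = {d \<in> E. \<not> shrinks d f \<and> \<not> shrinks (prod.swap d) f}"
  define S where "S = \<lparr>pverts = fst ` F, parcs = F\<rparr>"
  have FE: "F \<subseteq> E" by (auto simp: F_def)
  \<comment> \<open>So the subtree is not empty, while the trivial relation of \<open>f\<close> to
    itself keeps it proper.\<close>
  have eF: "e \<in> F" using neg assms(1) by (simp add: F_def)
  have fF: "f \<notin> F" using shrinks_subset[of f f] by (auto simp: F_def)
  have F_swap: "prod.swap d \<in> F" if "d \<in> F" for d
    using that swap_edge by (auto simp: F_def)
  have F_sym: "(v, u) \<in> F" if "(u, v) \<in> F" for u v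
    using F_swap[OF that] by simp
  have F_tr: "tr g d \<in> F" if "g \<in> carrier \<Gamma>" "d \<in> F" for g d
  proof -
    have "d \<in> E" "prod.swap d \<in> E" using that(2) FE swap_edge by blast+
    then show ?thesis using that assms(2) shrinks_tr(1)[OF that(1) _ assms(2)]
      by (auto simp: F_def edge_tr simp flip: tr_swap)
  qed
  have S_bidirected: "pair_bidirected_digraph S"
  proof
    show "fst d \<in> pverts S" if "d \<in> parcs S" for d using that by (simp add: S_def)
    show "snd d \<in> pverts S" if "d \<in> parcs S" for d
      using F_swap[of d] that by (force simp: S_def)
    show "symmetric (with_proj S)" using F_sym by (auto simp: symmetric_def S_def intro: symI)
    show "fst d \<noteq> snd d" if "d \<in> parcs S" for d
      using that FE pair_no_loops by (auto simp: S_def)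
  qed
  then interpret S: pair_bidirected_digraph S .
  \<comment> \<open>Convexity: on a path ending at an edge of \<open>F\<close>, a shrinking edge
    would force that edge to shrink in one of its orientations.\<close>
  have path_avoids: "\<not> shrinks (p i, p (Suc i)) f"
    if p: "nb_path T p n" "i < n" "(p n, w) \<in> F" for p n i w
  proof
    assume s: "shrinks (p i, p (Suc i)) f"
    have "(p n, w) \<in> E" "(w, p n) \<in> E" using p(3) FE edge_sym by auto
    moreover have "(p i, p (Suc i)) \<in> E" using p by (simp add: nb_path_def)
    ultimately have "shrinks (p n, w) f \<or> shrinks (w, p n) f"
      using H_end_edge[OF p(1,2)] s shrinks_mono by blast
    then show False using p(3) by (simp add: F_def)
  qed
  have reach: "reachable (with_proj S) u v" if uv: "u \<in> fst ` F" "v \<in> fst ` F" for u v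
  proof -
    obtain u' v' where uv': "(u, u') \<in> F" "(v, v') \<in> F" using uv by force
    have "u \<in> pverts T" "v \<in> pverts T" using uv' FE in_arcsD1 by blast+
    then obtain p n where p: "nb_path T p n" "p 0 = u" "p n = v" by (rule exists_nb_path)
    \<comment> \<open>\<open>path_avoids\<close> controls edges only in the direction of travel; the
      reversed path handles the opposite orientations.\<close>
    define q where "q k = p (n - k)" for k
    have q: "nb_path T q n"
      unfolding nb_path_def
    proof (intro conjI allI impI)
      fix i assume "i < n"
      then have "(p (n - Suc i), p (Suc (n - Suc i))) \<in> E" using p(1) by (simp add: nb_path_def)
      then show "(q i, q (Suc i)) \<in> E" using \<open>i < n\<close> edge_sym by (simp add: q_def Suc_diff_Suc)
    next
      fix i assume i: "i + 2 \<le> n"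
      then have "p (n - (i + 2)) \<noteq> p (n - (i + 2) + 2)" using p(1) by (simp add: nb_path_def)
      moreover have "n - (i + 2) + 2 = n - i" using i by simp
      ultimately show "q i \<noteq> q (i + 2)" by (simp add: q_def)
    qed
    have pF: "(p i, p (Suc i)) \<in> F" if "i < n" for i
    proof -
      have "\<not> shrinks (p i, p (Suc i)) f" using path_avoids[OF p(1) that] p(3) uv' by blast
      moreover have "\<not> shrinks (q (n - Suc i), q (Suc (n - Suc i))) f"
        using path_avoids[OF q, of "n - Suc i"] that p(2) uv' by (simp add: q_def)
      then have "\<not> shrinks (p (Suc i), p i) f" using that by (simp add: q_def Suc_diff_Suc)
      moreover have "(p i, p (Suc i)) \<in> E" using p(1) that by (simp add: nb_path_def)
      ultimately show ?thesis by (simp add: F_def)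
    qed
    have "k \<le> n \<Longrightarrow> reachable (with_proj S) (p 0) (p k)" for k
    proof (induction k)
      case 0
      show ?case by (rule S.reachable_refl) (use uv(1) p(2) in \<open>simp add: S_def\<close>)
    next
      case (Suc k)
      then have "reachable (with_proj S) (p 0) (p k)" "(p k, p (Suc k)) \<in> arcs_ends (with_proj S)"
        using pF[of k] by (simp_all add: S_def)
      then show ?case by (rule wf_digraph.reachable_adj_trans[OF S.wf_digraph_axioms])
    qed
    then show ?thesis using p by blast
  qed
  have S_connected: "Digraph_Component.connected (with_proj S)"
  proof -
    have "mk_symmetric (with_proj S) = S"
      using F_sym by (auto simp: mk_symmetric_def S_def)
    then show ?thesis
      using reach eF by (auto simp: Digraph_Component.connected_def strongly_connected_def S_def)
  qed
  have S_sub: "parcs S \<subseteq> parcs T" "pverts S \<subseteq> pverts T"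
    using FE in_arcsD1 by (auto simp: S_def)
  have "is_tree S"
    using S_bidirected S_connected cycle_mono[OF _ S_sub] tree by (auto simp: is_tree_def)
  moreover have "subgraph (with_proj S) (with_proj T)"
    unfolding subgraph_def compatible_def using S_sub wf_digraph_axioms S.wf_digraph_axioms by simp
  ultimately have "subtree S T" by (simp add: subtree_def)
  moreover have "invariant_subgraph \<Gamma> \<phi> S"
    unfolding invariant_subgraph_def
  proof
    fix g assume g: "g \<in> carrier \<Gamma>"
    have F_im: "tr g ` F = F"
    proof
      show "tr g ` F \<subseteq> F" by (rule image_subsetI) (rule F_tr[OF g])
      show "F \<subseteq> tr g ` F"
      proof
        fix d assume "d \<in> F"
        then have "d = tr g (tr (inv\<^bsub>\<Gamma>\<^esub> g) d)" using tr_inv(2)[OF g] FE by (metis subsetD)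
        moreover have "tr (inv\<^bsub>\<Gamma>\<^esub> g) d \<in> F" using \<open>d \<in> F\<close> g by (intro F_tr) auto
        ultimately show "d \<in> tr g ` F" by (rule image_eqI)
      qed
    qed
    have "\<phi> g ` fst ` F = fst ` tr g ` F" by (simp add: image_image)
    then show "\<phi> g ` pverts S = pverts S \<and> tr g ` parcs S = parcs S"
      using F_im by (simp add: S_def)
  qed
  ultimately have "S = T" by (rule minimal)
  then show False using fF assms(2) by (auto simp: S_def)
qed

text \<open>Otherwise the translates of \<open>e\<close> would define an invariant orientation of all edges, in which
  every vertex has at most one outgoing edge. Following the orientation leads to a fixed vertex or
  to a fixed end.\<close>

theorem all_shrink:
  assumes "e \<in> E" "f \<in> E"
  shows "shrinks e f"
proof (rule ccontr)
  assume neg: "\<not> shrinks e f"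
  have "shrinks (prod.swap e) f" using shrinks_or_swap assms neg by blast
  then have e_swap: "\<not> shrinks e (prod.swap e)"
    using neg shrinks_trans assms swap_edge by blast
  define P where "P = {d \<in> E. shrinks e d}"
  have PE: "(u, v) \<in> E" if "(u, v) \<in> P" for u v using that by (simp add: P_def)
  \<comment> \<open>The dichotomy is applied with target \<open>prod.swap e\<close>; passing to
    complements turns it into a statement with source \<open>e\<close>.\<close>
  have P_total: "(u, v) \<in> P \<or> (v, u) \<in> P" if "(u, v) \<in> E" for u v
  proof -
    have "shrinks (u, v) (prod.swap e) \<or> shrinks (v, u) (prod.swap e)"
      using shrinks_or_swap[of "(u, v)" "prod.swap e"] that assms(1) swap_edge by simp
    then have "shrinks e (v, u) \<or> shrinks e (u, v)"
      using shrinks_swap[of _ "prod.swap e"] that edge_sym assms(1) swap_edge by fastforce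
    then show ?thesis using that edge_sym by (auto simp: P_def)
  qed
  have P_anti: "(v, u) \<notin> P" if "(u, v) \<in> P" for u v
  proof
    assume "(v, u) \<in> P"
    then have "shrinks e (v, u)" "(v, u) \<in> E" "shrinks e (u, v)" "(u, v) \<in> E"
      using that by (auto simp: P_def)
    then have "shrinks (v, u) (prod.swap e)" using shrinks_swap[of e "(u, v)"] assms(1) by simp
    then show False
      using e_swap shrinks_trans[of e "(v, u)" "prod.swap e"] \<open>shrinks e (v, u)\<close> \<open>(v, u) \<in> E\<close>
        assms(1) swap_edge by blast
  qed
  \<comment> \<open>Distinct edges leaving \<open>v\<close> have disjoint halftrees, so the first
    halftree lies in that of the reversed second edge, which would then be oriented both
    ways.\<close>
  have P_unique: "w = w'" if "(v, w) \<in> P" "(v, w') \<in> P" for v w w'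
  proof (rule ccontr)
    assume "w \<noteq> w'"
    then have "H (v, w) \<subseteq> H (w', v)"
      using H_same_tail[of v w w'] H_swap[of v w'] H_subset[of "(v, w)"] that PE by blast
    then have "shrinks (v, w) (w', v)" using that PE shrinks_subset by blast
    then have "shrinks e (w', v)"
      using shrinks_trans[of e "(v, w)"] that assms(1) edge_sym by (auto simp: P_def)
    then have "(w', v) \<in> P" using that edge_sym by (auto simp: P_def)
    then show False using P_anti that(2) by blast
  qed
  have P_tr: "(\<phi> g u, \<phi> g v) \<in> P" if "g \<in> carrier \<Gamma>" "(u, v) \<in> P" for g u v
    using that shrinks_tr(2)[OF that(1) assms(1), of "(u, v)"] edge_tr[OF that(1), of "(u, v)"]
    by (simp add: P_def)
  show False
  proof (cases "\<exists>v\<in>pverts T. \<forall>w. (v, w) \<notin> P")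
    case True
    then obtain v where v: "v \<in> pverts T" "\<And>w. (v, w) \<notin> P" by blast
    have unique: "u = v" if u: "u \<in> pverts T" "\<And>w. (u, w) \<notin> P" for u
    proof (rule ccontr)
      assume "u \<noteq> v"
      obtain p n where p: "nb_path T p n" "p 0 = u" "p n = v" by (rule exists_nb_path[OF u(1) v(1)])
      \<comment> \<open>The first edge must point back to \<open>u\<close>, which has no outgoing
        edge; each later one points back too because its tail already has its only outgoing edge. In
        the end \<open>v\<close> would have an outgoing edge.\<close>
      have "i < n \<longrightarrow> (p (Suc i), p i) \<in> P" for i
      proof (induction i)
        case 0
        show ?case using P_total p u(2) by (fastforce simp: nb_path_def)
      next
        case (Suc i)
        show ?case
        proof
          assume i: "Suc i < n"
          then have "(p (Suc i), p i) \<in> P" "p i \<noteq> p (i + 2)" "(p (Suc i), p (i + 2)) \<in> E"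
            using Suc p(1) by (auto simp: nb_path_def)
          then have "(p (Suc i), p (i + 2)) \<notin> P" using P_unique by blast
          then show "(p (Suc (Suc i)), p (Suc i)) \<in> P"
            using P_total \<open>(p (Suc i), p (i + 2)) \<in> E\<close> by auto
        qed
      qed
      moreover have "n \<noteq> 0" using p(2,3) \<open>u \<noteq> v\<close> by metis
      ultimately have "(p n, p (n - 1)) \<in> P" by (metis Suc_pred' diff_less less_one not_gr_zero)
      then show False using v(2) p(3) by simp
    qed
    have fixed: "\<phi> g v = v" if g: "g \<in> carrier \<Gamma>" for g
    proof (rule unique)
      show "\<phi> g v \<in> pverts T" using vertex_in g v(1) by blast
      show "(\<phi> g v, w) \<notin> P" for w
        using P_tr[of "inv\<^bsub>\<Gamma>\<^esub> g" "\<phi> g v" w] g v by (auto simp: vertex_inv)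
    qed
    \<comment> \<open>The fixed vertex alone is an invariant subtree, and a proper one since
      \<open>T\<close> has the edge \<open>e\<close>.\<close>
    define S where "S = \<lparr>pverts = {v}, parcs = ({} :: ('v \<times> 'v) set)\<rparr>"
    have S_bidirected: "pair_bidirected_digraph S"
      by unfold_locales (auto simp: S_def symmetric_def sym_def)
    then interpret S: pair_bidirected_digraph S .
    have "mk_symmetric (with_proj S) = S" by (simp add: mk_symmetric_def S_def)
    moreover have "reachable (with_proj S) v v" by (rule S.reachable_refl) (simp add: S_def)
    ultimately have "Digraph_Component.connected (with_proj S)"
      by (simp add: Digraph_Component.connected_def strongly_connected_def) (simp add: S_def)
    then have "is_tree S"
      using S_bidirected cycle_mono[of S _ T] tree v(1) by (auto simp: is_tree_def S_def)
    moreover have "subgraph (with_proj S) (with_proj T)"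
      unfolding subgraph_def compatible_def using v(1) wf_digraph_axioms S.wf_digraph_axioms
      by (simp add: S_def)
    moreover have "invariant_subgraph \<Gamma> \<phi> S"
      using fixed by (simp add: invariant_subgraph_def S_def)
    ultimately have "S = T" using minimal by (simp add: subtree_def)
    then show False using assms(1) by (auto simp: S_def)
  next
    case False
    define next_vertex where "next_vertex v = (THE w. (v, w) \<in> P)" for v
    have nxt: "(v, next_vertex v) \<in> P" if "v \<in> pverts T" for v
    proof -
      obtain w where w: "(v, w) \<in> P" using False \<open>v \<in> pverts T\<close> by blast
      show ?thesis unfolding next_vertex_def by (rule theI, rule w, rule P_unique[OF _ w])
    qed
    define s where "s v n = (next_vertex ^^ n) v" for v n
    have s_verts: "s v n \<in> pverts T" if "v \<in> pverts T" for v n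
    proof (induction n)
      case (Suc n)
      then show ?case using PE[OF nxt] in_arcsD2 by (fastforce simp: s_def)
    qed (use that in \<open>simp add: s_def\<close>)
    have sP: "(s v n, s v (Suc n)) \<in> P" if "v \<in> pverts T" for v n
      using nxt[OF s_verts[OF that, of n]] by (simp add: s_def)
    have s_ray: "is_ray T (s v)" if "v \<in> pverts T" for v
      unfolding is_ray_def
    proof (intro conjI allI)
      show "(s v n, s v (Suc n)) \<in> E" for n using PE sP[OF that] by blast
      show "s v n \<noteq> s v (n + 2)" for n
        using P_anti[OF sP[OF that, of n]] sP[OF that, of "Suc n"] by auto
    qed
    \<comment> \<open>Following one oriented edge only removes the first vertex of the orbit, so by
      connectedness all orbits define the same end.\<close>
    have s_step: "(s v, s w) \<in> ray_equiv T" if "(v, w) \<in> P" for v w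
    proof -
      have v: "v \<in> pverts T" using PE that in_arcsD1 by blast
      have "w = next_vertex v" using P_unique that nxt[OF v] by blast
      then have "s w = (\<lambda>k. s v (Suc k))" by (simp add: s_def fun_eq_iff funpow_swap1)
      then show ?thesis using ray_equiv_Suc[OF s_ray[OF v]] by simp
    qed
    have s_equiv: "(s v, s w) \<in> ray_equiv T" if vw: "v \<in> pverts T" "w \<in> pverts T" for v w
      using connected_rtrancl[OF vw]
    proof (induction rule: rtrancl_induct)
      case base
      show ?case using s_ray[OF vw(1)] by (auto simp: ray_equiv_def)
    next
      case (step w w')
      then have "(s w, s w') \<in> ray_equiv T" using P_total s_step ray_equiv_sym by blast
      with step show ?case using ray_equiv_trans by blast
    qed
    have v: "fst e \<in> pverts T" (is "?v \<in> _") using assms(1) edge_verts by blast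
    let ?\<xi> = "ray_equiv T `` {s ?v}"
    obtain g where g: "g \<in> carrier \<Gamma>" "\<alpha> g ?\<xi> \<noteq> ?\<xi>"
      using no_fixed_end class_in_bd s_ray[OF v] by blast
    \<comment> \<open>The orientation is invariant and outgoing edges are unique, so
      \<open>g\<close> carries orbits to orbits and fixes their common end.\<close>
    have "\<phi> g (s ?v n) = s (\<phi> g ?v) n" for n
    proof (induction n)
      case (Suc n)
      have "(s (\<phi> g ?v) n, \<phi> g (s ?v (Suc n))) \<in> P"
        using P_tr[OF g(1) sP[OF v, of n]] Suc by simp
      then show ?case using P_unique sP[OF vertex_in[OF g(1) v]] by blast
    qed (simp add: s_def)
    then have "\<phi> g \<circ> s ?v = s (\<phi> g ?v)" by (simp add: fun_eq_iff)
    moreover have "ray_equiv T `` {s (\<phi> g ?v)} = ?\<xi>"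
      using s_equiv[OF vertex_in[OF g(1) v] v] class_eq_iff s_ray vertex_in[OF g(1) v] v by blast
    ultimately show False using g boundary_action_class[OF g(1) s_ray[OF v]] by simp
  qed
qed

text \<open>The complement of \<open>A\<close> contains a halftree, so \<open>A\<close> lies in the
  opposite one, and \<open>all_shrink\<close> moves that into a halftree inside
  \<open>B\<close>.\<close>

corollary extremely_proximal:
  assumes "closedin (boundary_topology T) A" "A \<noteq> bd" "openin (boundary_topology T) B" "B \<noteq> {}"
  obtains g where "g \<in> carrier \<Gamma>" "\<alpha> g ` A \<subseteq> B"
proof -
  have A: "A \<subseteq> bd" using closedin_subset[OF assms(1)] topspace_boundary by simp
  moreover have "openin (boundary_topology T) (bd - A)"
    using assms(1) by (simp add: closedin_def topspace_boundary)
  ultimately obtain e where e: "e \<in> E" "H e \<subseteq> bd - A" using halftree_nbhd assms(2) by blast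
  obtain f where f: "f \<in> E" "H f \<subseteq> B" using halftree_nbhd assms(3,4) by blast
  obtain g where g: "g \<in> carrier \<Gamma>" "H (tr g (prod.swap e)) \<subseteq> H f"
    using all_shrink[OF swap_edge[OF e(1)] f(1)] by (auto simp: shrinks_def)
  have "\<alpha> g \<xi> \<in> B" if "\<xi> \<in> A" for \<xi>
  proof -
    have "\<xi> \<in> H (prod.swap e)" using that A e by (auto simp: H_prod_swap)
    then show ?thesis using H_tr[OF g(1) swap_edge[OF e(1)]] g(2) f(2) by blast
  qed
  with g(1) that show ?thesis by blast
qed

end

section \<open>Topological full groups as groups of permutations\<close>

text \<open>A basic open set constrains finitely many coordinates; flipping a free one gives a
  second point in it.\<close>

lemma cantor_space_no_isolated_point:
  assumes "cantor_space X"
  shows "\<not> openin X {x}"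
proof
  assume x: "openin X {x}"
  let ?P = "product_topology (\<lambda>_::nat. discrete_topology (UNIV :: bool set)) UNIV"
  obtain f where f: "homeomorphic_map X ?P f"
    using assms homeomorphic_space by (auto simp: cantor_space_def)
  have "x \<in> topspace X" using openin_subset[OF x] by simp
  have "openin ?P {f x}"
    using homeomorphic_imp_open_map[OF f] x unfolding open_map_def by (metis image_empty image_insert)
  then obtain U where U: "finite {i. U i \<noteq> (UNIV :: bool set)}" "f x \<in> Pi\<^sub>E UNIV U" "Pi\<^sub>E UNIV U \<subseteq> {f x}"
    by (auto simp: openin_product_topology_alt)
  then obtain n where n: "U n = UNIV" using ex_new_if_finite[OF infinite_UNIV_nat] by blast
  have "(f x)(n := \<not> f x n) \<in> Pi\<^sub>E UNIV U" using U(2) n by (auto simp: PiE_iff)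
  then have "(f x)(n := \<not> f x n) = f x" using U(3) by blast
  then show False by (metis fun_upd_same)
qed

locale topological_action = group \<Gamma>
  for \<Gamma> :: "('g, 'm) monoid_scheme" and X :: "'a topology" and \<alpha> :: "'g \<Rightarrow> 'a \<Rightarrow> 'a" +
  assumes act_continuous: "g \<in> carrier \<Gamma> \<Longrightarrow> continuous_map X X (\<alpha> g)"
    and act_mult: "g \<in> carrier \<Gamma> \<Longrightarrow> h \<in> carrier \<Gamma> \<Longrightarrow> x \<in> topspace X \<Longrightarrow> \<alpha> (g \<otimes>\<^bsub>\<Gamma>\<^esub> h) x = \<alpha> g (\<alpha> h x)"
    and act_one: "x \<in> topspace X \<Longrightarrow> \<alpha> \<one>\<^bsub>\<Gamma>\<^esub> x = x"
begin

abbreviation "XX \<equiv> topspace X"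
abbreviation "TFG \<equiv> topological_full_group \<Gamma> X \<alpha>"

text \<open>The topological full group, carried over to permutations that are the identity off the
  space. Continuity in both directions follows from the local description and is derived in
  \<open>to_fun_homeomorphic\<close>.\<close>

definition full_perms :: "'a permutation set" where
  "full_perms = {b. supported_on XX b \<and> (\<forall>x\<in>XX. \<exists>U g. openin X U \<and> x \<in> U \<and> g \<in> carrier \<Gamma> \<and>
     (\<forall>y\<in>U. app b y = \<alpha> g y))}"

lemma act_in: "g \<in> carrier \<Gamma> \<Longrightarrow> x \<in> XX \<Longrightarrow> \<alpha> g x \<in> XX"
  using continuous_map_image_subset_topspace[OF act_continuous] by blast

lemma act_inv: "g \<in> carrier \<Gamma> \<Longrightarrow> x \<in> XX \<Longrightarrow> \<alpha> (inv\<^bsub>\<Gamma>\<^esub> g) (\<alpha> g x) = x"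
  using act_mult[of "inv\<^bsub>\<Gamma>\<^esub> g" g x] act_one by simp

lemma act_inv': "g \<in> carrier \<Gamma> \<Longrightarrow> x \<in> XX \<Longrightarrow> \<alpha> g (\<alpha> (inv\<^bsub>\<Gamma>\<^esub> g) x) = x"
  using act_mult[of g "inv\<^bsub>\<Gamma>\<^esub> g" x] act_one by simp

lemma act_image: "g \<in> carrier \<Gamma> \<Longrightarrow> U \<subseteq> XX \<Longrightarrow> \<alpha> g ` U = {x \<in> XX. \<alpha> (inv\<^bsub>\<Gamma>\<^esub> g) x \<in> U}"
  by (auto simp: act_in act_inv subset_iff) (metis act_inv' image_eqI)

lemma act_open: "g \<in> carrier \<Gamma> \<Longrightarrow> openin X U \<Longrightarrow> openin X (\<alpha> g ` U)"
  using openin_continuous_map_preimage[OF act_continuous[of "inv\<^bsub>\<Gamma>\<^esub> g"], of U] openin_subset[of X U]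
  by (simp add: act_image)

lemma full_permsE:
  assumes "b \<in> full_perms" "x \<in> XX"
  obtains U g where "openin X U" "x \<in> U" "U \<subseteq> XX" "g \<in> carrier \<Gamma>" "\<And>y. y \<in> U \<Longrightarrow> app b y = \<alpha> g y"
proof -
  have "\<exists>U g. openin X U \<and> x \<in> U \<and> g \<in> carrier \<Gamma> \<and> (\<forall>y\<in>U. app b y = \<alpha> g y)"
    using assms by (simp add: full_perms_def)
  then obtain U g where "openin X U" "x \<in> U" "g \<in> carrier \<Gamma>" "\<forall>y\<in>U. app b y = \<alpha> g y"
    by (elim exE conjE)
  then show ?thesis using that openin_subset by metis
qed

lemma full_permsI:
  assumes "supported_on XX b"
    and "\<And>x. x \<in> XX \<Longrightarrow> \<exists>U g. openin X U \<and> x \<in> U \<and> g \<in> carrier \<Gamma> \<and> (\<forall>y\<in>U. app b y = \<alpha> g y)"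
  shows "b \<in> full_perms"
  using assms by (simp add: full_perms_def)

lemma full_perms_supported: "b \<in> full_perms \<Longrightarrow> supported_on XX b"
  by (simp add: full_perms_def)

lemma full_perms_in: "b \<in> full_perms \<Longrightarrow> x \<in> XX \<Longrightarrow> app b x \<in> XX"
  by (rule supported_on_app_in[OF full_perms_supported])

lemma full_perms_open_preimage:
  assumes b: "b \<in> full_perms" and V: "openin X V"
  shows "openin X {x \<in> XX. app b x \<in> V}"
proof (subst openin_subopen, intro ballI)
  fix x assume "x \<in> {x \<in> XX. app b x \<in> V}"
  then have x: "x \<in> XX" "app b x \<in> V" by auto
  obtain U g where U: "openin X U" "x \<in> U" "U \<subseteq> XX" "g \<in> carrier \<Gamma>" "\<And>y. y \<in> U \<Longrightarrow> app b y = \<alpha> g y"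
    by (rule full_permsE[OF b x(1)]) blast
  have "openin X (U \<inter> {y \<in> XX. \<alpha> g y \<in> V})"
    by (rule openin_Int[OF U(1) openin_continuous_map_preimage[OF act_continuous[OF U(4)] V]])
  moreover have "x \<in> U \<inter> {y \<in> XX. \<alpha> g y \<in> V}" using x U(2) U(5)[of x] by simp
  moreover have "U \<inter> {y \<in> XX. \<alpha> g y \<in> V} \<subseteq> {x \<in> XX. app b x \<in> V}" using U(5) by auto
  ultimately show "\<exists>W. openin X W \<and> x \<in> W \<and> W \<subseteq> {x \<in> XX. app b x \<in> V}" by blast
qed

lemma full_perms_mult:
  assumes "b \<in> full_perms" "c \<in> full_perms"
  shows "b * c \<in> full_perms"
proof (rule full_permsI)
  show "supported_on XX (b * c)" using assms by (simp add: full_perms_supported supported_on_mult)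
  fix x assume x: "x \<in> XX"
  obtain U g where U: "openin X U" "x \<in> U" "U \<subseteq> XX" "g \<in> carrier \<Gamma>" "\<And>y. y \<in> U \<Longrightarrow> app c y = \<alpha> g y"
    by (rule full_permsE[OF assms(2) x]) blast
  obtain V h where V: "openin X V" "app c x \<in> V" "V \<subseteq> XX" "h \<in> carrier \<Gamma>" "\<And>y. y \<in> V \<Longrightarrow> app b y = \<alpha> h y"
    by (rule full_permsE[OF assms(1) full_perms_in[OF assms(2) x]]) blast
  let ?W = "U \<inter> {y \<in> XX. app c y \<in> V}"
  have "openin X ?W" using U(1) full_perms_open_preimage[OF assms(2) V(1)] by blast
  moreover have "app (b * c) y = \<alpha> (h \<otimes>\<^bsub>\<Gamma>\<^esub> g) y" if "y \<in> ?W" for y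
    using that U(4,5) V(4) V(5)[of "app c y"] act_mult[of h g y] by auto
  ultimately show "\<exists>U g. openin X U \<and> x \<in> U \<and> g \<in> carrier \<Gamma> \<and> (\<forall>y\<in>U. app (b * c) y = \<alpha> g y)"
    using x U(2,4) V(2,4) by (intro exI[of _ ?W] exI[of _ "h \<otimes>\<^bsub>\<Gamma>\<^esub> g"]) simp
qed

lemma full_perms_inverse:
  assumes b: "b \<in> full_perms"
  shows "inverse b \<in> full_perms"
proof (rule full_permsI)
  show sup: "supported_on XX (inverse b)" using b by (simp add: full_perms_supported supported_on_inverse)
  fix x assume x: "x \<in> XX"
  have xx: "app (inverse b) x \<in> XX" by (rule supported_on_app_in[OF sup x])
  obtain U g where U: "openin X U" "app (inverse b) x \<in> U" "U \<subseteq> XX" "g \<in> carrier \<Gamma>"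
    "\<And>y. y \<in> U \<Longrightarrow> app b y = \<alpha> g y"
    by (rule full_permsE[OF b xx]) blast
  have "x = \<alpha> g (app (inverse b) x)" using U(5)[OF U(2)] by simp
  then have "x \<in> \<alpha> g ` U" using U(2) by (rule image_eqI)
  moreover have "app (inverse b) y = \<alpha> (inv\<^bsub>\<Gamma>\<^esub> g) y" if y: "y \<in> \<alpha> g ` U" for y
  proof -
    obtain z where z: "z \<in> U" "y = \<alpha> g z" using y by blast
    then have "app (inverse b) y = z" using U(5) by (metis app_inverse_app)
    then show ?thesis using z(2) act_inv[OF U(4), of z] z(1) U(3) by (simp add: subset_iff)
  qed
  ultimately show "\<exists>U g. openin X U \<and> x \<in> U \<and> g \<in> carrier \<Gamma> \<and> (\<forall>y\<in>U. app (inverse b) y = \<alpha> g y)"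
    using act_open[OF U(4,1)] U(4)
    by (intro exI[of _ "\<alpha> g ` U"] exI[of _ "inv\<^bsub>\<Gamma>\<^esub> g"]) simp
qed

lemma full_perms_subgroup: "perm_subgroup full_perms"
proof -
  have "1 \<in> full_perms"
    using act_one openin_topspace
    by (intro full_permsI exI[of _ XX] exI[of _ "\<one>\<^bsub>\<Gamma>\<^esub>"]) (auto simp: supported_on_one)
  then show ?thesis by (simp add: perm_subgroup_def full_perms_mult full_perms_inverse)
qed

lemma full_perms_image:
  assumes "b \<in> full_perms" "A \<subseteq> XX"
  shows "app b ` A = {x \<in> XX. app (inverse b) x \<in> A}"
proof (intro equalityI subsetI)
  fix x assume "x \<in> app b ` A"
  then show "x \<in> {x \<in> XX. app (inverse b) x \<in> A}" using assms full_perms_in by auto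
qed (simp add: in_image_app_iff)

lemma full_perms_open_image:
  "b \<in> full_perms \<Longrightarrow> openin X U \<Longrightarrow> openin X (app b ` U)"
  using full_perms_open_preimage[OF full_perms_inverse] by (simp add: full_perms_image openin_subset)

lemma full_perms_closed_image:
  assumes "b \<in> full_perms" "closedin X A"
  shows "closedin X (app b ` A)"
proof -
  have "app b ` A \<subseteq> XX" using full_perms_image[OF assms(1) closedin_subset[OF assms(2)]] by simp
  moreover have "XX - app b ` A = app b ` (XX - A)"
    using full_perms_image[OF assms(1), of A] full_perms_image[OF assms(1), of "XX - A"]
      closedin_subset[OF assms(2)] full_perms_in[OF full_perms_inverse[OF assms(1)]] by auto
  ultimately show ?thesis using assms by (simp add: closedin_def full_perms_open_image)
qed

section \<open>Identification with the topological full group\<close>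

definition act_perm :: "'g \<Rightarrow> 'a permutation" where
  "act_perm g = Permutation (\<lambda>x. if x \<in> XX then \<alpha> g x else x)"

lemma app_act_perm:
  assumes "g \<in> carrier \<Gamma>"
  shows "app (act_perm g) x = (if x \<in> XX then \<alpha> g x else x)"
proof -
  have "bij (\<lambda>x. if x \<in> XX then \<alpha> g x else x)"
    by (rule o_bij[of "\<lambda>x. if x \<in> XX then \<alpha> (inv\<^bsub>\<Gamma>\<^esub> g) x else x"])
      (use assms in \<open>auto simp: fun_eq_iff act_in act_inv act_inv'\<close>)
  then show ?thesis by (simp add: act_perm_def app_Permutation)
qed

lemma act_perm_in: "g \<in> carrier \<Gamma> \<Longrightarrow> act_perm g \<in> full_perms"
  by (rule full_permsI) (auto simp: supported_on_def app_act_perm intro!: exI[of _ XX] exI[of _ g])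

definition to_fun :: "'a permutation \<Rightarrow> 'a \<Rightarrow> 'a" where
  "to_fun b = restrict (app b) XX"

lemma to_fun_Bij: "b \<in> full_perms \<Longrightarrow> to_fun b \<in> Bij XX"
  using full_perms_image[of b XX] full_perms_in[OF full_perms_inverse]
  by (auto simp: to_fun_def Bij_def bij_betw_def inj_on_def app_eq_iff)

lemma to_fun_homeomorphic:
  assumes "b \<in> full_perms"
  shows "homeomorphic_map X X (to_fun b)"
proof -
  have "homeomorphic_maps X X (app b) (app (inverse b))"
    using assms full_perms_open_preimage[OF assms] full_perms_open_preimage[OF full_perms_inverse[OF assms]]
      full_perms_in[OF assms] full_perms_in[OF full_perms_inverse[OF assms]]
    by (auto simp: homeomorphic_maps_def continuous_map_def)
  then have "homeomorphic_map X X (app b)" using homeomorphic_map_maps by blast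
  then show ?thesis by (rule homeomorphic_map_eq) (simp add: to_fun_def)
qed

lemma carrier_TFG: "carrier TFG = to_fun ` full_perms"
proof
  show "to_fun ` full_perms \<subseteq> carrier TFG"
  proof
    fix f assume "f \<in> to_fun ` full_perms"
    then obtain b where b: "b \<in> full_perms" "f = to_fun b" by blast
    have "\<exists>U. openin X U \<and> x \<in> U \<and> (\<exists>g\<in>carrier \<Gamma>. \<forall>y\<in>U. to_fun b y = \<alpha> g y)" if "x \<in> XX" for x
    proof -
      obtain U g where U: "openin X U" "x \<in> U" "U \<subseteq> XX" "g \<in> carrier \<Gamma>" "\<And>y. y \<in> U \<Longrightarrow> app b y = \<alpha> g y"
        by (rule full_permsE[OF b(1) \<open>x \<in> XX\<close>]) blast
      then have "\<forall>y\<in>U. to_fun b y = \<alpha> g y" by (auto simp: to_fun_def)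
      then show ?thesis using U by blast
    qed
    then show "f \<in> carrier TFG"
      using b to_fun_Bij to_fun_homeomorphic
      by (simp add: topological_full_group_def homeo_group_def)
  qed
  show "carrier TFG \<subseteq> to_fun ` full_perms"
  proof
    fix f assume "f \<in> carrier TFG"
    then have f: "f \<in> Bij XX"
      "\<And>x. x \<in> XX \<Longrightarrow> \<exists>U. openin X U \<and> x \<in> U \<and> (\<exists>g\<in>carrier \<Gamma>. \<forall>y\<in>U. f y = \<alpha> g y)"
      by (auto simp: topological_full_group_def homeo_group_def)
    \<comment> \<open>Elements of the group are undefined off the space; replacing that default by
      the identity gives a permutation of the whole type.\<close>
    define f' where "f' x = (if x \<in> XX then f x else x)" for x
    have "bij_betw f' XX XX" using f(1) by (simp add: Bij_def f'_def cong: bij_betw_cong)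
    moreover have "bij_betw f' (- XX) (- XX)" by (simp add: bij_betw_def inj_on_def f'_def image_def)
    ultimately have "bij_betw f' (XX \<union> - XX) (XX \<union> - XX)" by (rule bij_betw_combine) simp
    then have "bij f'" by simp
    then have app: "app (Permutation f') = f'" by (rule app_Permutation)
    have "Permutation f' \<in> full_perms"
    proof (rule full_permsI)
      show "supported_on XX (Permutation f')" by (simp add: supported_on_def app f'_def)
      fix x assume "x \<in> XX"
      then obtain U g where "openin X U" "x \<in> U" "g \<in> carrier \<Gamma>" "\<forall>y\<in>U. f y = \<alpha> g y"
        using f(2) by blast
      moreover from this have "\<forall>y\<in>U. app (Permutation f') y = \<alpha> g y"
        using openin_subset by (fastforce simp: app f'_def)
      ultimately show "\<exists>U g. openin X U \<and> x \<in> U \<and> g \<in> carrier \<Gamma> \<and>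
          (\<forall>y\<in>U. app (Permutation f') y = \<alpha> g y)" by blast
    qed
    moreover have "to_fun (Permutation f') = f"
      using f(1) by (auto simp: to_fun_def app f'_def fun_eq_iff Bij_def extensional_def)
    ultimately show "f \<in> to_fun ` full_perms" by blast
  qed
qed

lemma to_fun_mult:
  assumes "b \<in> full_perms" "c \<in> full_perms"
  shows "to_fun b \<otimes>\<^bsub>TFG\<^esub> to_fun c = to_fun (b * c)"
  using assms to_fun_Bij full_perms_in
  by (auto simp: topological_full_group_def homeo_group_def BijGroup_def compose_def to_fun_def
      fun_eq_iff)

lemma to_fun_one: "to_fun 1 = \<one>\<^bsub>TFG\<^esub>"
  by (auto simp: topological_full_group_def homeo_group_def BijGroup_def to_fun_def fun_eq_iff)

lemma one_in_full_perms: "1 \<in> full_perms"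
  using full_perms_subgroup by (simp add: perm_subgroup_def)

lemma group_TFG: "group TFG"
proof (rule groupI)
  fix f g h assume "f \<in> carrier TFG" "g \<in> carrier TFG" "h \<in> carrier TFG"
  then show "f \<otimes>\<^bsub>TFG\<^esub> g \<otimes>\<^bsub>TFG\<^esub> h = f \<otimes>\<^bsub>TFG\<^esub> (g \<otimes>\<^bsub>TFG\<^esub> h)"
    by (auto simp: carrier_TFG to_fun_mult full_perms_mult mult.assoc)
next
  fix f assume "f \<in> carrier TFG"
  then obtain b where b: "b \<in> full_perms" "f = to_fun b" by (auto simp: carrier_TFG)
  then have "to_fun (inverse b) \<otimes>\<^bsub>TFG\<^esub> f = \<one>\<^bsub>TFG\<^esub>"
    by (simp add: to_fun_mult full_perms_inverse flip: to_fun_one)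
  then show "\<exists>g\<in>carrier TFG. g \<otimes>\<^bsub>TFG\<^esub> f = \<one>\<^bsub>TFG\<^esub>"
    using full_perms_inverse[OF b(1)] by (auto simp: carrier_TFG)
qed (auto simp: carrier_TFG to_fun_mult full_perms_mult one_in_full_perms simp flip: to_fun_one)

sublocale TFG: group TFG by (rule group_TFG)

lemma to_fun_inverse: "b \<in> full_perms \<Longrightarrow> inv\<^bsub>TFG\<^esub> (to_fun b) = to_fun (inverse b)"
  by (rule TFG.inv_equality)
    (auto simp: to_fun_mult full_perms_inverse carrier_TFG simp flip: to_fun_one)

section \<open>The commutator subgroup and its uniform simplicity\<close>

abbreviation "DG \<equiv> commutator_products full_perms"

lemma DG_in: "b \<in> DG \<Longrightarrow> b \<in> full_perms"
  using commutator_products_subset[OF full_perms_subgroup] by blast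

lemma to_fun_commutator:
  "a \<in> full_perms \<Longrightarrow> b \<in> full_perms \<Longrightarrow>
    to_fun a \<otimes>\<^bsub>TFG\<^esub> to_fun b \<otimes>\<^bsub>TFG\<^esub> inv\<^bsub>TFG\<^esub> (to_fun a) \<otimes>\<^bsub>TFG\<^esub> inv\<^bsub>TFG\<^esub> (to_fun b)
      = to_fun (commutator a b)"
  by (simp add: to_fun_mult to_fun_inverse full_perms_mult full_perms_inverse commutator_def)

lemma derived_TFG: "derived TFG (carrier TFG) = to_fun ` DG"
proof
  show "derived TFG (carrier TFG) \<subseteq> to_fun ` DG"
  proof
    fix f assume "f \<in> derived TFG (carrier TFG)"
    then have "f \<in> generate TFG (derived_set TFG (carrier TFG))" by (simp add: derived_def)
    then show "f \<in> to_fun ` DG"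
    proof (induction rule: generate.induct)
      case one
      then show ?case by (auto simp: commutator_products.one simp flip: to_fun_one)
    next
      case (incl f)
      then obtain a b where "a \<in> full_perms" "b \<in> full_perms" "f = to_fun (commutator a b)"
        by (auto simp: carrier_TFG to_fun_commutator)
      then show ?case by (auto intro: commutator_in_commutator_products)
    next
      case (inv f)
      then obtain a b where "a \<in> full_perms" "b \<in> full_perms" "f = to_fun (commutator a b)"
        by (auto simp: carrier_TFG to_fun_commutator)
      moreover from this have "commutator a b \<in> DG" by (blast intro: commutator_in_commutator_products)
      ultimately show ?case
        by (auto simp: to_fun_inverse DG_in intro: commutator_products_inverse)
    next
      case (eng f g)
      then obtain a b where "a \<in> DG" "b \<in> DG" "f = to_fun a" "g = to_fun b" by auto
      then show ?case using to_fun_mult[OF DG_in DG_in] commutator_products_mult by blast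
    qed
  qed
  have "to_fun f \<in> derived TFG (carrier TFG)" if "f \<in> DG" for f
    using that
  proof (induction rule: commutator_products.induct)
    case one
    then show ?case by (simp add: to_fun_one derived_def generate.one)
  next
    case (step a b f)
    have "to_fun (commutator a b) \<in> derived_set TFG (carrier TFG)"
      using step(1,2) by (auto simp: carrier_TFG simp flip: to_fun_commutator)
    then have "to_fun (commutator a b) \<otimes>\<^bsub>TFG\<^esub> to_fun f \<in> derived TFG (carrier TFG)"
      using step(4) unfolding derived_def by (blast intro: generate.eng generate.incl)
    moreover have "commutator a b \<in> full_perms"
      using step(1,2) commutator_in_commutator_products DG_in by blast
    ultimately show ?case using step(3) DG_in by (simp add: to_fun_mult)
  qed
  then show "to_fun ` DG \<subseteq> derived TFG (carrier TFG)" by blast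
qed

lemma foldr_to_fun:
  "set xs \<subseteq> full_perms \<Longrightarrow>
    prod_list xs \<in> full_perms \<and> foldr (\<otimes>\<^bsub>TFG\<^esub>) (map to_fun xs) \<one>\<^bsub>TFG\<^esub> = to_fun (prod_list xs)"
  by (induction xs) (auto simp: to_fun_one one_in_full_perms full_perms_mult to_fun_mult)

text \<open>Passing to the full group is idempotent: intersecting two neighbourhoods replaces local
  agreement with \<open>c\<close> by local agreement with \<open>\<Gamma>\<close>. This is the
  gluing axiom of \<open>proximal_full_group\<close>.\<close>

lemma full_group_local:
  assumes "supported_on XX b"
    and "\<And>x. x \<in> XX \<Longrightarrow> \<exists>U. openin X U \<and> x \<in> U \<and> (\<exists>c\<in>full_perms. \<forall>y\<in>U. app b y = app c y)"
  shows "b \<in> full_perms"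
proof (rule full_permsI[OF assms(1)])
  fix x assume x: "x \<in> XX"
  then obtain U c where U: "openin X U" "x \<in> U" "c \<in> full_perms" "\<forall>y\<in>U. app b y = app c y"
    using assms(2) by blast
  obtain V g where V: "openin X V" "x \<in> V" "V \<subseteq> XX" "g \<in> carrier \<Gamma>" "\<And>y. y \<in> V \<Longrightarrow> app c y = \<alpha> g y"
    by (rule full_permsE[OF U(3) x]) blast
  show "\<exists>U g. openin X U \<and> x \<in> U \<and> g \<in> carrier \<Gamma> \<and> (\<forall>y\<in>U. app b y = \<alpha> g y)"
    by (rule exI[of _ "U \<inter> V"], rule exI[of _ g]) (use U V in auto)
qed

theorem uniformly_simple_commutator_subgroup:
  assumes separated: "\<And>x y. x \<in> XX \<Longrightarrow> y \<in> XX \<Longrightarrow> x \<noteq> y \<Longrightarrow>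
      \<exists>A. openin X A \<and> closedin X A \<and> x \<in> A \<and> y \<notin> A"
    and perfect: "\<And>x. \<not> openin X {x}"
    and proximal: "\<And>A B. closedin X A \<Longrightarrow> A \<noteq> XX \<Longrightarrow> openin X B \<Longrightarrow> B \<noteq> {} \<Longrightarrow>
      \<exists>g\<in>carrier \<Gamma>. \<alpha> g ` A \<subseteq> B"
  shows "uniformly_simple 8 (commutator_subgroup TFG)"
proof -
  let ?C = "{A. openin X A \<and> closedin X A}"
  interpret proximal_full_group XX ?C full_perms
  proof
    show "\<exists>A\<in>?C. x \<in> A \<and> y \<notin> A" if "x \<in> XX" "y \<in> XX" "x \<noteq> y" for x y
      using separated[OF that] by blast
    show "perm_subgroup full_perms" by (rule full_perms_subgroup)
    show "h \<in> full_perms" if "supported_on XX h"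
      "\<And>x. x \<in> XX \<Longrightarrow> \<exists>A\<in>?C. x \<in> A \<and> (\<exists>g\<in>full_perms. \<forall>y\<in>A. app h y = app g y)" for h
      using that(1)
    proof (rule full_group_local)
      fix x assume "x \<in> XX"
      from that(2)[OF this]
      show "\<exists>U. openin X U \<and> x \<in> U \<and> (\<exists>c\<in>full_perms. \<forall>y\<in>U. app h y = app c y)" by blast
    qed
    show "\<exists>g\<in>full_perms. app g ` A \<subseteq> B" if AB: "A \<in> ?C" "A \<noteq> XX" "B \<in> ?C" "B \<noteq> {}" for A B
    proof -
      obtain g where g: "g \<in> carrier \<Gamma>" "\<alpha> g ` A \<subseteq> B" using proximal[of A B] AB by auto
      have "app (act_perm g) ` A = \<alpha> g ` A"
        using AB closedin_subset by (auto simp: app_act_perm[OF g(1)] image_iff)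
      then show ?thesis using g act_perm_in[OF g(1)] by (intro bexI[of _ "act_perm g"]) simp_all
    qed
    show "A \<subseteq> XX" if "A \<in> ?C" for A using that openin_subset by blast
    show "XX - A \<in> ?C" if "A \<in> ?C" for A
      using that by (auto intro: openin_diff closedin_diff)
    show "A \<inter> B \<in> ?C" if "A \<in> ?C" "B \<in> ?C" for A B
      using that by (auto intro: openin_Int closedin_Int)
    show "XX \<in> ?C" by simp
    show "{x} \<notin> ?C" for x using perfect by simp
    show "supported_on XX g" if "g \<in> full_perms" for g using that by (rule full_perms_supported)
    show "app g ` A \<in> ?C" if "g \<in> full_perms" "A \<in> ?C" for g A
      using that by (simp add: full_perms_open_image full_perms_closed_image)
  qed
  let ?K = "commutator_subgroup TFG"
  have carrier_K: "carrier ?K = to_fun ` DG" by (simp add: commutator_subgroup_def derived_TFG)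
  have mult_K: "monoid.mult ?K = monoid.mult TFG" and one_K: "\<one>\<^bsub>?K\<^esub> = \<one>\<^bsub>TFG\<^esub>"
    by (simp_all add: commutator_subgroup_def)
  have sub: "subgroup (to_fun ` DG) TFG"
    using TFG.derived_is_subgroup[of "carrier TFG"] by (simp add: derived_TFG)
  have "?K = TFG\<lparr>carrier := to_fun ` DG\<rparr>" by (simp add: commutator_subgroup_def derived_TFG)
  then have group_K: "group ?K" and inv_K: "inv\<^bsub>?K\<^esub> (to_fun b) = to_fun (inverse b)" if "b \<in> DG" for b
    using TFG.subgroup_imp_group[OF sub] TFG.m_inv_consistent[OF sub] that
    by (simp_all add: to_fun_inverse DG_in)
  have "group ?K" using group_K[OF commutator_products.one] .
  moreover have "\<exists>xs. length xs \<le> 8 \<and> set xs \<subseteq> C \<union> m_inv ?K ` C \<and> f = foldr (monoid.mult ?K) xs \<one>\<^bsub>?K\<^esub>"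
    if f: "f \<in> carrier ?K - {\<one>\<^bsub>?K\<^esub>}" and C: "C \<in> conj_class ?K ` carrier ?K - {{\<one>\<^bsub>?K\<^esub>}}" for f C
  proof -
    obtain b where b: "b \<in> DG" "f = to_fun b" "b \<noteq> 1"
      using f by (auto simp: carrier_K one_K simp flip: to_fun_one)
    obtain c where c: "c \<in> DG" "C = conj_class ?K (to_fun c)" using C by (auto simp: carrier_K)
    \<comment> \<open>The conjugacy class is taken in the commutator subgroup, which matches
      conjugation by \<open>DG\<close> in \<open>conjugates\<close>.\<close>
    have C_eq: "C = to_fun ` conjugates c"
    proof -
      have "C = {to_fun h \<otimes>\<^bsub>?K\<^esub> to_fun c \<otimes>\<^bsub>?K\<^esub> inv\<^bsub>?K\<^esub> (to_fun h) | h. h \<in> DG}"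
        unfolding c(2) conj_class_def carrier_K by blast
      also have "\<dots> = {to_fun (h * c * inverse h) | h. h \<in> DG}"
        using c(1) by (intro Collect_cong ex_cong1)
          (auto simp: mult_K inv_K to_fun_mult DG_in full_perms_mult full_perms_inverse)
      finally show ?thesis by (auto simp: conjugates_def)
    qed
    have "c \<noteq> 1"
    proof
      assume "c = 1"
      then have "conjugates c = {1}" using commutator_products.one by (auto simp: conjugates_def)
      then show False using C by (simp add: C_eq one_K to_fun_one)
    qed
    obtain xs where xs: "length xs = 8" "set xs \<subseteq> conjugates c \<union> conjugates (inverse c)" "b = prod_list xs"
      using product_of_eight_conjugates[OF b(1,3) c(1) \<open>c \<noteq> 1\<close>] .
    have conj_DG: "conjugates d \<subseteq> DG" if "d \<in> DG" for d
      using that by (auto simp: conjugates_def intro: D_conjugate DG_in)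
    \<comment> \<open>Conjugates of \<open>inverse c\<close> are exactly the inverses of conjugates
      of \<open>c\<close>.\<close>
    have "to_fun x \<in> C \<union> m_inv ?K ` C" if "x \<in> set xs" for x
    proof (cases "x \<in> conjugates c")
      case False
      then have "x \<in> conjugates (inverse c)" using that xs(2) by blast
      then have x': "inverse x \<in> conjugates c" using conjugates_inverse[of x "inverse c"] by simp
      then have "m_inv ?K (to_fun (inverse x)) = to_fun x"
        using inv_K[of "inverse x"] conj_DG[OF c(1)] by auto
      then show ?thesis using x' by (metis C_eq UnI2 imageI)
    qed (simp add: C_eq)
    moreover have "set xs \<subseteq> full_perms"
      using xs(2) conj_DG[OF c(1)] conj_DG[OF commutator_products_inverse[OF c(1)]] DG_in by blast
    ultimately show ?thesis
      using foldr_to_fun[of xs] xs(1,3) b(2)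
      by (intro exI[of _ "map to_fun xs"]) (auto simp: mult_K one_K)
  qed
  ultimately show ?thesis unfolding uniformly_simple_def by blast
qed

end

section \<open>Application to the boundary of the tree\<close>

lemma uniformly_simple_mono: "uniformly_simple M G \<Longrightarrow> M \<le> N \<Longrightarrow> uniformly_simple N G"
  unfolding uniformly_simple_def by (meson order_trans)

theorem theorem1p3:
  fixes \<Gamma> :: "('g, 'm) monoid_scheme"
    and T :: "'v pair_pre_digraph"
    and \<phi> :: "'g \<Rightarrow> 'v \<Rightarrow> 'v"
  assumes "acts_on_tree \<Gamma> T \<phi>"
    and "leafless T"
    and "cantor_space (boundary_topology T)"
    and "\<not> (\<exists>S. subtree S T \<and> S \<noteq> T \<and> invariant_subgraph \<Gamma> \<phi> S)"
    and "\<not> (\<exists>\<xi> \<in> tree_boundary T. \<forall>g \<in> carrier \<Gamma>. boundary_action T \<phi> g \<xi> = \<xi>)"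
  shows "uniformly_simple 9 (commutator_subgroup
           (topological_full_group \<Gamma> (boundary_topology T) (boundary_action T \<phi>)))"
proof -
  interpret minimal_tree_action \<Gamma> T \<phi>
    by unfold_locales (use assms in \<open>auto simp: acts_on_tree_def\<close>)
  let ?X = "boundary_topology T"
  have cont: "continuous_map ?X ?X (\<alpha> g)" if g: "g \<in> carrier \<Gamma>" for g
    unfolding continuous_map_alt topspace_boundary
  proof (intro conjI allI impI)
    show "\<alpha> g \<in> bd \<rightarrow> bd" using \<alpha>_in[OF g] by blast
    fix U assume U: "openin ?X U"
    show "openin ?X (\<alpha> g -` U \<inter> bd)"
    proof (subst openin_subopen, intro ballI)
      fix \<xi> assume "\<xi> \<in> \<alpha> g -` U \<inter> bd"
      then have \<xi>: "\<xi> \<in> bd" "\<alpha> g \<xi> \<in> U" by auto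
      obtain e where e: "e \<in> E" "\<alpha> g \<xi> \<in> H e" "H e \<subseteq> U" using halftree_nbhd[OF U \<xi>(2)] by blast
      \<comment> \<open>The halftree of this translate is carried by \<open>g\<close> into the
        halftree of \<open>e\<close>, hence is a neighbourhood of \<open>\<xi>\<close> inside the
        preimage of \<open>U\<close>.\<close>
      let ?e = "tr (inv\<^bsub>\<Gamma>\<^esub> g) e"
      have e': "?e \<in> E" "tr g ?e = e" using e(1) g by (simp_all add: edge_tr tr_inv)
      have "\<xi> \<in> H ?e" using H_tr_iff[OF g e'(1) \<xi>(1)] e' e(2) by simp
      moreover have "H ?e \<subseteq> \<alpha> g -` U \<inter> bd"
        using H_tr[OF g e'(1)] e' e(3) H_subset[OF e'(1)] by auto
      ultimately show "\<exists>W. openin ?X W \<and> \<xi> \<in> W \<and> W \<subseteq> \<alpha> g -` U \<inter> bd"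
        using openin_H[OF e'(1)] by blast
    qed
  qed
  interpret topological_action \<Gamma> ?X \<alpha>
    by unfold_locales
      (simp_all add: cont topspace_boundary \<alpha>_mult \<alpha>_one)
  have "uniformly_simple 8 (commutator_subgroup TFG)"
  proof (rule uniformly_simple_commutator_subgroup)
    show "\<not> openin ?X {\<xi>}" for \<xi> by (rule cantor_space_no_isolated_point[OF assms(3)])
    show "\<exists>g\<in>carrier \<Gamma>. \<alpha> g ` A \<subseteq> B"
      if "closedin ?X A" "A \<noteq> topspace ?X" "openin ?X B" "B \<noteq> {}" for A B
      using extremely_proximal[of A B] that by (auto simp: topspace_boundary)
    show "\<exists>A. openin ?X A \<and> closedin ?X A \<and> \<xi> \<in> A \<and> \<eta> \<notin> A"
      if \<xi>\<eta>: "\<xi> \<in> topspace ?X" "\<eta> \<in> topspace ?X" "\<xi> \<noteq> \<eta>" for \<xi> \<eta>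
      using ends_separated[of \<xi> \<eta>] that openin_H closedin_H unfolding topspace_boundary by blast
  qed
  then show ?thesis by (rule uniformly_simple_mono) simp
qed

end
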